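(* Let $(a,x,y)\in\mathcal{S}_{\mathrm{GCPP}}$ and $\eta=a-x$. Then \[ \kappa[\mathcal{S}_{\mathrm{GCPP}}](a,x,y)=\|(\mathrm{D}_{(x,y)}\pi_{\mathcal{O}})(\mathrm{D}_{(x,y)}\pi_{\mathcal{I}})^{-1}H_\eta^{-1}\|_{\mathcal{I}\to\mathcal{O}}, \] where $\pi_{\mathcal{I}}:\mathcal{S}\to\mathcal{I}$ and $\pi_{\mathcal{O}}:\mathcal{S}\to\mathcal{O}$ are the coordinate projections, $H_\eta=\mathbf{1}-S_\eta$, and the right-hand side is read as $+\infty$ if one of the inverses does not exist. Moreover, if $(a,x,y)\in\mathcal{S}_{\mathrm{GCPP}}\setminus\mathcal{W}_{\mathrm{GCPP}}$, then either $\mathrm{D}_{(x,y)}\pi_{\mathcal{I}}$ or $H_\eta$ is not invertible.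
   Context: Standing assumptions: $\mathcal{I}\subset\mathbb{R}^n$ is an $m$-dimensional embedded smooth submanifold with the Riemannian metric inherited from the Euclidean inner product; $\mathcal{O}$ is a smooth Riemannian manifold; $\mathcal{S}\subset\mathcal{I}\times\mathcal{O}$ is a smoothly embedded $m$-dimensional submanifold with coordinate projections $\pi_{\mathcal{I}}:\mathcal{S}\to\mathcal{I}$ and $\pi_{\mathcal{O}}:\mathcal{S}\to\mathcal{O}$; $\pi_{\mathcal{I}}$ is surjective; and the set $\mathcal{W}=\{(x,y)\in\mathcal{S}\mid \mathrm{D}_{(x,y)}\pi_{\mathcal{I}}\text{ is invertible}\}$ of well-posed tuples is an open dense embedded submanifold of $\mathcal{S}$. $\mathrm{D}_pF$ denotes the derivative of $F$ at $p$, and $\mathrm{N}_x\mathcal{I}=(\mathrm{T}_x\mathcal{I})^\perp\subset\mathbb{R}^n$. $\mathcal{S}_{\mathrm{CPP}}=\{(a,x)\in\mathbb{R}^n\times\mathcal{I}\mid a-x\in\mathrm{N}_x\mathcal{I}\}$ is an $n$-dimensional embedded submanifold of $\mathbb{R}^n\times\mathcal{I}$, and $\mathcal{W}_{\mathrm{CPP}}$ is the set of $(a,x)\in\mathcal{S}_{\mathrm{CPP}}$ at which the coordinate projection $\mathcal{S}_{\mathrm{CPP}}\to\mathbb{R}^n$ has invertible derivative. Define $\mathcal{S}_{\mathrm{GCPP}}=\{(a,x,y)\in\mathbb{R}^n\times\mathcal{I}\times\mathcal{O}\mid(a,x)\in\mathcal{S}_{\mathrm{CPP}},\ (x,y)\in\mathcal{S}\}$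 and $\mathcal{W}_{\mathrm{GCPP}}=\{(a,x,y)\in\mathbb{R}^n\times\mathcal{I}\times\mathcal{O}\mid(a,x)\in\mathcal{W}_{\mathrm{CPP}},\ (x,y)\in\mathcal{W}\}$; the latter is an embedded submanifold of dimension $n$. With $\Pi_{\mathbb{R}^n}:\mathcal{W}_{\mathrm{GCPP}}\to\mathbb{R}^n$ and $\Pi_{\mathcal{O}}:\mathcal{W}_{\mathrm{GCPP}}\to\mathcal{O}$ the coordinate projections, the condition number at $(a,x,y)\in\mathcal{W}_{\mathrm{GCPP}}$ is $\kappa[\mathcal{S}_{\mathrm{GCPP}}](a,x,y)=\|(\mathrm{D}_{(a,x,y)}\Pi_{\mathcal{O}})(\mathrm{D}_{(a,x,y)}\Pi_{\mathbb{R}^n})^{-1}\|_{\mathbb{R}^n\to\mathcal{O}}$ (and $+\infty$ if the inverse does not exist); at points of $\mathcal{S}_{\mathrm{GCPP}}\setminus\mathcal{W}_{\mathrm{GCPP}}$ (ill-posed triples) it is $+\infty$. Here $\|A\|_{\mathcal{M}\to\mathcal{N}}=\sup_{t\neq0}\|At\|_{\mathcal{N}}/\|t\|_{\mathcal{M}}$ is the spectral norm of a linear map between tangent spaces of Riemannian manifolds $\mathcal{M},\mathcal{N}$. For $\eta\in\mathrm{N}_x\mathcal{I}$, the Weingarten map $S_\eta:\mathrm{T}_x\mathcal{I}\to\mathrm{T}_x\mathcal{I}$ is the self-adjoint map with $\langle S_\eta(v),w\rangle=\langle\mathit{I\!I}_x(v,w),\eta\rangle$, where $\mathit{I\!I}_x(v,w)\in\mathrm{N}_x\mathcal{I}$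 is the second fundamental form (the normal component of the Euclidean directional derivative along $v$ of a tangent vector field extending $w$), and $H_\eta:=\mathbf{1}-S_\eta$ with $\mathbf{1}$ the identity of $\mathrm{T}_x\mathcal{I}$. *)

theory Defs
  imports "HOL-Analysis.Analysis"
begin

section \<open>Smooth maps\<close>

text \<open>\<open>Ck_on k U f\<close>, for open \<open>U\<close>: \<open>f\<close> is \<open>k\<close> times continuously differentiable on \<open>U\<close>.\<close>

fun Ck_on :: "nat \<Rightarrow> 'a::euclidean_space set \<Rightarrow> ('a \<Rightarrow> 'b::real_normed_vector) \<Rightarrow> bool" where
  "Ck_on 0 U f \<longleftrightarrow> continuous_on U f"
| "Ck_on (Suc k) U f \<longleftrightarrow>
     (\<forall>x\<in>U. f differentiable (at x)) \<and> (\<forall>v. Ck_on k U (\<lambda>x. frechet_derivative f (at x) v))"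

text \<open>Smoothness on a set that need not be open (for instance a relatively open subset of a
  linear subspace) means having local smooth extensions.\<close>

definition smooth_on :: "'a::euclidean_space set \<Rightarrow> ('a \<Rightarrow> 'b::real_normed_vector) \<Rightarrow> bool" where
  "smooth_on S f \<longleftrightarrow>
     (\<forall>x\<in>S. \<exists>U h. open U \<and> x \<in> U \<and> (\<forall>k. Ck_on k U h) \<and> (\<forall>z\<in>S \<inter> U. h z = f z))"

section \<open>Smooth manifolds\<close>

text \<open>A manifold is represented by an atlas. Its underlying set is the union of the chart domains,
  with the topology inherited from the ambient type. Only the values of a chart on its domain are
  meaningful. Charts take values in a linear subspace of a Euclidean space, so that manifolds of
  every dimension, including 0, are covered.\<close>

type_synonym ('p, 'e) chart = "'p set \<times> ('p \<Rightarrow> 'e)"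

definition carrier :: "('p, 'e) chart set \<Rightarrow> 'p set" where
  "carrier A = (\<Union>c\<in>A. fst c)"

definition chart_inv :: "('p, 'e) chart \<Rightarrow> 'e \<Rightarrow> 'p" where
  "chart_inv c = inv_into (fst c) (snd c)"

definition is_chart ::
  "'p::topological_space set \<Rightarrow> 'e::euclidean_space set \<Rightarrow> ('p, 'e) chart \<Rightarrow> bool" where
  "is_chart M E c \<longleftrightarrow>
     openin (top_of_set M) (fst c) \<and>
     openin (top_of_set E) (snd c ` fst c) \<and>
     homeomorphism (fst c) (snd c ` fst c) (snd c) (chart_inv c)"

definition compatible :: "('p, 'e::euclidean_space) chart \<Rightarrow> ('p, 'e) chart \<Rightarrow> bool" where
  "compatible c d \<longleftrightarrow>
     smooth_on (snd c ` (fst c \<inter> fst d)) (snd d \<circ> chart_inv c) \<and>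
     smooth_on (snd d ` (fst c \<inter> fst d)) (snd c \<circ> chart_inv d)"

definition smooth_manifold ::
  "nat \<Rightarrow> ('p::{t2_space,second_countable_topology}, 'e::euclidean_space) chart set \<Rightarrow> bool" where
  "smooth_manifold k A \<longleftrightarrow>
     (\<forall>c\<in>A. \<exists>E. subspace E \<and> dim E = k \<and> is_chart (carrier A) E c) \<and>
     (\<forall>c\<in>A. \<forall>d\<in>A. compatible c d)"

definition euclidean_atlas :: "('a::euclidean_space, 'a) chart set" where
  "euclidean_atlas = {(UNIV, id)}"

definition prod_atlas ::
  "('p, 'e) chart set \<Rightarrow> ('q, 'f) chart set \<Rightarrow> ('p \<times> 'q, 'e \<times> 'f) chart set" where
  "prod_atlas A B = {(fst c \<times> fst d, map_prod (snd c) (snd d)) | c d. c \<in> A \<and> d \<in> B}"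

text \<open>The charts of the maximal atlas of the \<open>k\<close>-dimensional manifold \<open>A\<close> in which \<open>S\<close> is an
  \<open>m\<close>-dimensional linear slice.\<close>

definition slice_charts ::
  "nat \<Rightarrow> ('p::topological_space, 'e::euclidean_space) chart set \<Rightarrow> nat \<Rightarrow> 'p set \<Rightarrow> ('p, 'e) chart set"
  where
  "slice_charts k A m S = {c. \<exists>E L.
     subspace E \<and> dim E = k \<and> is_chart (carrier A) E c \<and> (\<forall>d\<in>A. compatible c d) \<and>
     subspace L \<and> L \<subseteq> E \<and> dim L = m \<and> snd c ` (fst c \<inter> S) = snd c ` fst c \<inter> L}"

definition embedded_submanifold ::
  "nat \<Rightarrow> ('p::topological_space, 'e::euclidean_space) chart set \<Rightarrow> nat \<Rightarrow> 'p set \<Rightarrow> bool" where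
  "embedded_submanifold k A m S \<longleftrightarrow> S \<subseteq> carrier (slice_charts k A m S)"

text \<open>The smooth structure of an embedded submanifold.\<close>

definition sub_atlas ::
  "nat \<Rightarrow> ('p::topological_space, 'e::euclidean_space) chart set \<Rightarrow> nat \<Rightarrow> 'p set \<Rightarrow> ('p, 'e) chart set"
  where
  "sub_atlas k A m S = (\<lambda>c. (fst c \<inter> S, snd c)) ` slice_charts k A m S"

section \<open>Tangent spaces and derivatives\<close>

text \<open>A tangent vector at \<open>p\<close> assigns to every chart of the atlas around \<open>p\<close> its coordinate vector
  in that chart (and 0 to everything else); the vector space operations are pointwise. The tangent
  space of an embedded submanifold \<open>S\<close> of the manifold \<open>A\<close> consists of the velocities of the
  smooth curves that lie in \<open>S\<close>; the tangent space of \<open>A\<close> itself is the case \<open>S = carrier A\<close>.\<close>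

type_synonym ('p, 'e) tangent_vector = "('p, 'e) chart \<Rightarrow> 'e"

definition curves ::
  "('p::topological_space, 'e::euclidean_space) chart set \<Rightarrow> 'p set \<Rightarrow> 'p \<Rightarrow> (real \<Rightarrow> 'p) set" where
  "curves A S p = {\<gamma>. \<gamma> 0 = p \<and> (\<exists>\<epsilon>>0.
     \<gamma> ` {-\<epsilon><..<\<epsilon>} \<subseteq> S \<and> continuous_on {-\<epsilon><..<\<epsilon>} \<gamma> \<and>
     (\<forall>c\<in>A. smooth_on ({-\<epsilon><..<\<epsilon>} \<inter> \<gamma> -` fst c) (snd c \<circ> \<gamma>)))}"

definition velocity ::
  "('p, 'e::euclidean_space) chart set \<Rightarrow> (real \<Rightarrow> 'p) \<Rightarrow> ('p, 'e) tangent_vector" where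
  "velocity A \<gamma> =
     (\<lambda>c. if c \<in> A \<and> \<gamma> 0 \<in> fst c then vector_derivative (snd c \<circ> \<gamma>) (at 0) else 0)"

definition tangent_space ::
  "('p::topological_space, 'e::euclidean_space) chart set \<Rightarrow> 'p set \<Rightarrow> 'p \<Rightarrow>
     ('p, 'e) tangent_vector set" where
  "tangent_space A S p = velocity A ` curves A S p"

text \<open>The derivative at \<open>p \<in> S\<close> of a smooth map \<open>F\<close> from the submanifold \<open>S\<close> of \<open>A\<close> to \<open>B\<close>
  sends the velocity of \<open>\<gamma>\<close> to the velocity of \<open>F \<circ> \<gamma>\<close>.\<close>

definition differential ::
  "('p::topological_space, 'e::euclidean_space) chart set \<Rightarrow> 'p set \<Rightarrow>
   ('q, 'f::euclidean_space) chart set \<Rightarrow> ('p \<Rightarrow> 'q) \<Rightarrow> 'p \<Rightarrow>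
   ('p, 'e) tangent_vector \<Rightarrow> ('q, 'f) tangent_vector" where
  "differential A S B F p v =
     velocity B (F \<circ> (SOME \<gamma>. \<gamma> \<in> curves A S p \<and> velocity A \<gamma> = v))"

definition riemannian_metric ::
  "('p::topological_space, 'e::euclidean_space) chart set \<Rightarrow>
   ('p \<Rightarrow> ('p, 'e) tangent_vector \<Rightarrow> ('p, 'e) tangent_vector \<Rightarrow> real) \<Rightarrow> bool" where
  "riemannian_metric A g \<longleftrightarrow>
     (\<forall>p\<in>carrier A. \<forall>u\<in>tangent_space A (carrier A) p. \<forall>v\<in>tangent_space A (carrier A) p.
        g p u v = g p v u \<and>
        (\<forall>w\<in>tangent_space A (carrier A) p. \<forall>r s.
           g p (\<lambda>c. r *\<^sub>R u c + s *\<^sub>R v c) w = r * g p u w + s * g p v w) \<and>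
        (u \<noteq> (\<lambda>c. 0) \<longrightarrow> g p u u > 0)) \<and>
     \<comment> \<open>The coefficients of \<open>g\<close> in every chart are smooth: \<open>X\<close> and \<open>Y\<close> are the vector fields on
         the chart domain with constant coordinate vectors \<open>e\<close> and \<open>f\<close>.\<close>
     (\<forall>c\<in>A. \<forall>e f X Y.
        (\<forall>p\<in>fst c. X p \<in> tangent_space A (carrier A) p \<and> X p c = e \<and>
                     Y p \<in> tangent_space A (carrier A) p \<and> Y p c = f) \<longrightarrow>
        smooth_on (snd c ` fst c)
          (\<lambda>z. g (chart_inv c z) (X (chart_inv c z)) (Y (chart_inv c z))))"

definition riemannian_norm :: "('t \<Rightarrow> 't \<Rightarrow> real) \<Rightarrow> 't \<Rightarrow> real" where
  "riemannian_norm b v = sqrt (b v v)"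

text \<open>The norm of \<open>F\<close> on a subspace \<open>T\<close> of a Euclidean space, with values measured by \<open>N\<close>. In
  \<open>ennreal\<close>, the supremum over the empty set is 0, as it should be for \<open>T = {0}\<close>.\<close>

definition spectral_norm :: "'a::euclidean_space set \<Rightarrow> ('t \<Rightarrow> real) \<Rightarrow> ('a \<Rightarrow> 't) \<Rightarrow> ennreal" where
  "spectral_norm T N F = (SUP t\<in>T - {0}. ennreal (N (F t) / norm t))"

section \<open>Submanifolds of Euclidean space\<close>

text \<open>The canonical identification of a tangent space of a Euclidean space with that space.\<close>

definition to_vec :: "('a, 'a) tangent_vector \<Rightarrow> 'a" where
  "to_vec v = v (UNIV, id)"

definition tangent :: "'a::euclidean_space set \<Rightarrow> 'a \<Rightarrow> 'a set" where
  "tangent I x = to_vec ` tangent_space euclidean_atlas I x"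

definition normal :: "'a::euclidean_space set \<Rightarrow> 'a \<Rightarrow> 'a set" where
  "normal I x = orthogonal_comp (tangent I x)"

definition normal_part :: "'a::euclidean_space set \<Rightarrow> 'a \<Rightarrow> 'a \<Rightarrow> 'a" where
  "normal_part I x u = (THE \<nu>. \<nu> \<in> normal I x \<and> u - \<nu> \<in> tangent I x)"

text \<open>Local tangent vector fields of \<open>I\<close> near \<open>x\<close> with value \<open>w\<close> at \<open>x\<close>, smoothly extended to a
  neighbourhood of \<open>x\<close> in the ambient space.\<close>

definition extending_fields :: "'a::euclidean_space set \<Rightarrow> 'a \<Rightarrow> 'a \<Rightarrow> ('a \<Rightarrow> 'a) set" where
  "extending_fields I x w = {X. X x = w \<and>
     (\<exists>U. open U \<and> x \<in> U \<and> smooth_on U X \<and> (\<forall>z\<in>I \<inter> U. X z \<in> tangent I z))}"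

definition second_fundamental_form :: "'a::euclidean_space set \<Rightarrow> 'a \<Rightarrow> 'a \<Rightarrow> 'a \<Rightarrow> 'a" where
  "second_fundamental_form I x v w =
     normal_part I x (frechet_derivative (SOME X. X \<in> extending_fields I x w) (at x) v)"

definition weingarten :: "'a::euclidean_space set \<Rightarrow> 'a \<Rightarrow> 'a \<Rightarrow> 'a \<Rightarrow> 'a" where
  "weingarten I x \<eta> v =
     (THE u. u \<in> tangent I x \<and>
        (\<forall>w\<in>tangent I x. u \<bullet> w = second_fundamental_form I x v w \<bullet> \<eta>))"

definition Hmap :: "'a::euclidean_space set \<Rightarrow> 'a \<Rightarrow> 'a \<Rightarrow> 'a \<Rightarrow> 'a" where
  "Hmap I x \<eta> v = v - weingarten I x \<eta> v"

section \<open>Condition numbers\<close>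

text \<open>Since \<open>I\<close> is an embedded submanifold of the Euclidean space \<open>'a\<close>, curves and tangent vectors
  in \<open>I \<times> O\<close> are taken in \<open>'a \<times> O\<close>. A linear map is invertible iff it is a bijection between the
  tangent spaces in question. In the following, \<open>A\<close> is an atlas of \<open>O\<close>.\<close>

abbreviation tangent_S ::
  "('o::topological_space, 'e::euclidean_space) chart set \<Rightarrow> ('a::euclidean_space \<times> 'o) set \<Rightarrow>
   'a \<times> 'o \<Rightarrow> ('a \<times> 'o, 'a \<times> 'e) tangent_vector set" where
  "tangent_S A S \<equiv> tangent_space (prod_atlas euclidean_atlas A) S"

definition D_pi_I ::
  "('o::topological_space, 'e::euclidean_space) chart set \<Rightarrow> ('a::euclidean_space \<times> 'o) set \<Rightarrow>
   'a \<times> 'o \<Rightarrow> ('a \<times> 'o, 'a \<times> 'e) tangent_vector \<Rightarrow> 'a" where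
  "D_pi_I A S p = to_vec \<circ> differential (prod_atlas euclidean_atlas A) S euclidean_atlas fst p"

definition D_pi_O ::
  "('o::topological_space, 'e::euclidean_space) chart set \<Rightarrow> ('a::euclidean_space \<times> 'o) set \<Rightarrow>
   'a \<times> 'o \<Rightarrow> ('a \<times> 'o, 'a \<times> 'e) tangent_vector \<Rightarrow> ('o, 'e) tangent_vector" where
  "D_pi_O A S p = differential (prod_atlas euclidean_atlas A) S A snd p"

definition well_posed ::
  "'a::euclidean_space set \<Rightarrow> ('o::topological_space, 'e::euclidean_space) chart set \<Rightarrow>
   ('a \<times> 'o) set \<Rightarrow> ('a \<times> 'o) set" where
  "well_posed I A S = {(x, y) \<in> S. bij_betw (D_pi_I A S (x, y)) (tangent_S A S (x, y)) (tangent I x)}"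

definition S_CPP :: "'a::euclidean_space set \<Rightarrow> ('a \<times> 'a) set" where
  "S_CPP I = {(a, x). x \<in> I \<and> a - x \<in> normal I x}"

definition W_CPP :: "'a::euclidean_space set \<Rightarrow> ('a \<times> 'a) set" where
  "W_CPP I = {p \<in> S_CPP I.
     bij_betw
       (to_vec \<circ> differential (prod_atlas euclidean_atlas euclidean_atlas) (S_CPP I)
                   euclidean_atlas fst p)
       (tangent_space (prod_atlas euclidean_atlas euclidean_atlas) (S_CPP I) p) UNIV}"

definition S_GCPP :: "'a::euclidean_space set \<Rightarrow> ('a \<times> 'o) set \<Rightarrow> ('a \<times> 'a \<times> 'o) set" where
  "S_GCPP I S = {(a, x, y). (a, x) \<in> S_CPP I \<and> (x, y) \<in> S}"

definition W_GCPP ::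
  "'a::euclidean_space set \<Rightarrow> ('o::topological_space, 'e::euclidean_space) chart set \<Rightarrow>
   ('a \<times> 'o) set \<Rightarrow> ('a \<times> 'a \<times> 'o) set" where
  "W_GCPP I A S = {(a, x, y). (a, x) \<in> W_CPP I \<and> (x, y) \<in> well_posed I A S}"

definition GCPP_atlas ::
  "('o, 'e) chart set \<Rightarrow> ('a::euclidean_space \<times> 'a \<times> 'o, 'a \<times> 'a \<times> 'e) chart set" where
  "GCPP_atlas A = prod_atlas euclidean_atlas (prod_atlas euclidean_atlas A)"

definition cond_GCPP ::
  "'a::euclidean_space set \<Rightarrow> ('o::topological_space, 'e::euclidean_space) chart set \<Rightarrow>
   ('o \<Rightarrow> ('o, 'e) tangent_vector \<Rightarrow> ('o, 'e) tangent_vector \<Rightarrow> real) \<Rightarrow>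
   ('a \<times> 'o) set \<Rightarrow> 'a \<times> 'a \<times> 'o \<Rightarrow> ennreal" where
  "cond_GCPP I A g S p =
     (let W = W_GCPP I A S;
          T = tangent_space (GCPP_atlas A) W p;
          D_Rn = to_vec \<circ> differential (GCPP_atlas A) W euclidean_atlas fst p;
          D_O = differential (GCPP_atlas A) W A (snd \<circ> snd) p
      in if p \<in> W \<and> bij_betw D_Rn T UNIV
         then spectral_norm UNIV (riemannian_norm (g (snd (snd p)))) (D_O \<circ> inv_into T D_Rn)
         else \<infinity>)"

end

theory Submission
  imports Defs
begin

text \<open>Everything is decided on velocities of curves. Let \<open>\<eta> = a - x\<close> and let \<open>P\<close> be the orthogonal
  projection onto the tangent space \<open>T\<close> of \<open>I\<close> at \<open>x\<close>. A curve \<open>(a(t), x(t))\<close> with \<open>x(t) \<in> I\<close> lies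
  in \<open>S_CPP I\<close> exactly if \<open>a(t) - x(t)\<close> is a normal field along \<open>x(t)\<close>, so it is orthogonal to every tangent
  field \<open>X\<close> of \<open>I\<close>. Differentiating \<open>X(x(t)) \<bullet> (a(t) - x(t)) = 0\<close> at \<open>t = 0\<close> expresses the second
  fundamental form in direction \<open>x'\<close>, paired with \<open>\<eta>\<close>, through the derivative of \<open>a(t) - x(t)\<close>;
  the outcome is \<open>H\<^sub>\<eta> x' = P a'\<close> (lemma \<open>Hmap_velocity\<close>), whichever extending field the
  definition of the second fundamental form selects.

  Conversely, every curve in \<open>I\<close> lifts to \<open>S_CPP I\<close>, and the lift can be given any initial velocity
  \<open>a'\<close> with \<open>P a' = H\<^sub>\<eta> x'\<close> (lemma \<open>lift_curve\<close>): if a diffeomorphism \<open>\<phi>\<close> flattens \<open>I\<close> to a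
  linear subspace \<open>L\<close>, then the normal space of \<open>I\<close> at \<open>z\<close> is the image of the orthogonal complement
  of \<open>L\<close> under the adjoint of the derivative of \<open>\<phi>\<close> at \<open>z\<close>, which depends smoothly on \<open>z\<close>. Hence the
  tangent space of \<open>S_CPP I\<close> is \<open>{(s, v). v \<in> T \<and> P s = H\<^sub>\<eta> v}\<close>, and its projection to the first
  component is bijective iff \<open>H\<^sub>\<eta>\<close> is bijective on \<open>T\<close> (lemma \<open>W_CPP_iff_Hmap\<close>). This settles which
  triples are well-posed.

  At a well-posed triple, the velocity \<open>(a', x', y')\<close> of a curve in \<open>W_GCPP\<close> is determined by \<open>a'\<close>:
  \<open>x' = H\<^sub>\<eta>\<inverse> P a'\<close>, and \<open>y'\<close> is the image of \<open>x'\<close> under the derivative of the solution map of \<open>S\<close>.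
  So the condition number is the norm, on the whole ambient space, of the operator in the theorem
  precomposed with \<open>P\<close>, and precomposing with an orthogonal projection does not change the norm
  (lemma \<open>spectral_norm_orth_proj\<close>). That every \<open>a'\<close> occurs needs curves that stay inside
  \<open>W_GCPP\<close>: they are lifts of curves in \<open>S\<close>, and they stay well-posed because \<open>well_posed\<close> is open in
  \<open>S\<close> by assumption and \<open>W_CPP I\<close> is open in \<open>S_CPP I\<close> (lemma \<open>W_CPP_open\<close>), being the locus where
  the derivative of a smooth map between spaces of equal dimension is invertible.\<close>

section \<open>Calculus of smooth maps\<close>

lemma Ck_on_subset: "Ck_on k U f \<Longrightarrow> V \<subseteq> U \<Longrightarrow> Ck_on k V f"
  by (induction k arbitrary: f) (auto intro: continuous_on_subset)

lemma Ck_on_cong: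
  assumes "open U" "Ck_on k U f" "\<And>x. x \<in> U \<Longrightarrow> f x = g x"
  shows "Ck_on k U g"
  using assms(2,3)
proof (induction k arbitrary: f g)
  case 0
  then show ?case by (auto cong: continuous_on_cong)
next
  case (Suc k)
  have d: "(g has_derivative frechet_derivative f (at x)) (at x)" if "x \<in> U" for x
  proof (rule has_derivative_transform_within_open[OF _ \<open>open U\<close> that])
    show "(f has_derivative frechet_derivative f (at x)) (at x)"
      using Suc.prems(1) that by (auto simp: frechet_derivative_works[symmetric])
  qed (use Suc.prems in auto)
  have "frechet_derivative g (at x) = frechet_derivative f (at x)" if "x \<in> U" for x
    using frechet_derivative_at[OF d[OF that]] by simp
  then show ?case
    using Suc.prems(1) d Suc.IH[of "\<lambda>x. frechet_derivative f (at x) v" "\<lambda>x. frechet_derivative g (at x) v" for v]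
    by (auto simp: differentiable_def)
qed

lemma Ck_on_local:
  assumes "\<And>x. x \<in> U \<Longrightarrow> \<exists>V. open V \<and> x \<in> V \<and> Ck_on k V f"
  shows "Ck_on k U f"
  using assms
proof (induction k arbitrary: f)
  case 0
  have "isCont f x" if "x \<in> U" for x
    using 0[OF that] by (auto simp: continuous_on_eq_continuous_at)
  then show ?case by (simp add: continuous_at_imp_continuous_on)
next
  case (Suc k)
  show ?case
  proof (simp, intro conjI allI ballI)
    fix x assume "x \<in> U"
    then show "f differentiable at x" using Suc.prems[of x] by auto
  next
    fix v
    show "Ck_on k U (\<lambda>x. frechet_derivative f (at x) v)"
      by (rule Suc.IH) (use Suc.prems in force)
  qed
qed

lemma Ck_on_SucD: "Ck_on (Suc k) U f \<Longrightarrow> Ck_on k U f"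
proof (induction k arbitrary: f)
  case 0
  then show ?case
    by (auto intro!: continuous_at_imp_continuous_on differentiable_imp_continuous_within)
next
  case (Suc k)
  then show ?case by auto
qed

lemma Ck_on_const: "Ck_on k U (\<lambda>x. c)"
  by (induction k arbitrary: c) (auto simp: frechet_derivative_const)

lemma Ck_on_SucI:
  assumes "open U" "\<And>x. x \<in> U \<Longrightarrow> (f has_derivative f' x) (at x)" "\<And>v. Ck_on k U (\<lambda>x. f' x v)"
  shows "Ck_on (Suc k) U f"
proof -
  have "frechet_derivative f (at x) = f' x" if "x \<in> U" for x
    using frechet_derivative_at[OF assms(2)[OF that]] by simp
  then have "Ck_on k U (\<lambda>x. frechet_derivative f (at x) v)" for v
    by (intro Ck_on_cong[OF assms(1) assms(3)[of v]]) simp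
  with assms(2) show ?thesis by (auto simp: differentiable_def)
qed

lemma Ck_on_has_derivative:
  "Ck_on (Suc k) U f \<Longrightarrow> x \<in> U \<Longrightarrow> (f has_derivative frechet_derivative f (at x)) (at x)"
  by (simp add: frechet_derivative_works[symmetric])

lemma Ck_on_linear_compose:
  assumes "bounded_linear h" "open U" "Ck_on k U f"
  shows "Ck_on k U (\<lambda>x. h (f x))"
  using assms(3)
proof (induction k arbitrary: f)
  case 0
  then show ?case using assms(1) by (simp add: bounded_linear.continuous_on)
next
  case (Suc k)
  show ?case
    by (rule Ck_on_SucI[OF \<open>open U\<close> bounded_linear.has_derivative[OF assms(1)]])
       (use Suc in \<open>auto intro: Ck_on_has_derivative[OF Suc.prems]\<close>)
qed

lemma Ck_on_ident: "open U \<Longrightarrow> Ck_on k U (\<lambda>x. x)"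
proof (cases k)
  case (Suc j)
  assume "open U"
  with Suc show ?thesis by (auto intro!: Ck_on_SucI Ck_on_const)
qed auto

lemma Ck_on_add:
  assumes "open U" "Ck_on k U f" "Ck_on k U g"
  shows "Ck_on k U (\<lambda>x. f x + g x)"
  using assms(2,3)
proof (induction k arbitrary: f g)
  case 0
  then show ?case by (simp add: continuous_on_add)
next
  case (Suc k)
  show ?case
    by (rule Ck_on_SucI[OF \<open>open U\<close> has_derivative_add])
       (use Suc in \<open>auto intro: Ck_on_has_derivative[OF Suc.prems(1)] Ck_on_has_derivative[OF Suc.prems(2)]\<close>)
qed

lemma Ck_on_sum:
  assumes "open U" "\<And>i. i \<in> B \<Longrightarrow> Ck_on k U (f i)"
  shows "Ck_on k U (\<lambda>x. \<Sum>i\<in>B. f i x)"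
  using assms(2)
  by (induction B rule: infinite_finite_induct) (auto intro: Ck_on_add assms(1) Ck_on_const)

text \<open>The product rule expresses the derivative through products of \<open>f\<close>, \<open>g\<close> and their derivatives,
  all of which are still \<open>k\<close> times continuously differentiable; hence the induction on \<open>k\<close> with
  arbitrary \<open>f\<close> and \<open>g\<close>.\<close>

lemma Ck_on_bilinear:
  assumes "bounded_bilinear h" "open U" "Ck_on k U f" "Ck_on k U g"
  shows "Ck_on k U (\<lambda>x. h (f x) (g x))"
  using assms(3,4)
proof (induction k arbitrary: f g)
  case 0
  then show ?case by (simp add: bounded_bilinear.continuous_on[OF assms(1)])
next
  case (Suc k)
  show ?case
  proof (rule Ck_on_SucI[OF \<open>open U\<close> bounded_bilinear.FDERIV[OF assms(1)]])
    fix v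
    show "Ck_on k U (\<lambda>x. h (f x) (frechet_derivative g (at x) v) + h (frechet_derivative f (at x) v) (g x))"
      using Suc.prems by (intro Ck_on_add Suc.IH assms(2) Ck_on_SucD[of k U f] Ck_on_SucD[of k U g]) auto
  qed (auto intro: Ck_on_has_derivative[OF Suc.prems(1)] Ck_on_has_derivative[OF Suc.prems(2)])
qed

text \<open>Expanding the inner derivative in the standard basis turns the chain rule into a finite sum of
  products of scalar functions with compositions \<open>(\<lambda>z. D g(z) b) \<circ> f\<close> for a fixed vector \<open>b\<close>.
  To these the induction hypothesis applies.\<close>

lemma Ck_on_compose:
  fixes f :: "'a::euclidean_space \<Rightarrow> 'b::euclidean_space"
  assumes "open U" "open V" "f ` U \<subseteq> V" "Ck_on k U f" "Ck_on k V g"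
  shows "Ck_on k U (\<lambda>x. g (f x))"
  using assms(4,5)
proof (induction k arbitrary: g)
  case 0
  then show ?case using assms(3) by (auto intro: continuous_on_compose2)
next
  case (Suc k)
  let ?Dg = "\<lambda>z. frechet_derivative g (at z)"
  show ?case
  proof (rule Ck_on_SucI[OF \<open>open U\<close>])
    fix x assume x: "x \<in> U"
    have *: "(f has_derivative frechet_derivative f (at x)) (at x)"
      by (rule Ck_on_has_derivative[OF Suc.prems(1) x])
    have g: "(g has_derivative ?Dg (f x)) (at (f x))"
      by (rule Ck_on_has_derivative[OF Suc.prems(2)]) (use x assms(3) in auto)
    have expand: "?Dg (f x) u = (\<Sum>b\<in>Basis. (u \<bullet> b) *\<^sub>R ?Dg (f x) b)" for u
      using linear_sum[OF has_derivative_linear[OF g], of "\<lambda>b. (u \<bullet> b) *\<^sub>R b" Basis]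
      by (simp add: euclidean_representation linear_scale[OF has_derivative_linear[OF g]])
    show "((\<lambda>x. g (f x)) has_derivative
        (\<lambda>v. \<Sum>b\<in>Basis. (frechet_derivative f (at x) v \<bullet> b) *\<^sub>R ?Dg (f x) b)) (at x)"
      by (rule has_derivative_eq_rhs[OF has_derivative_compose[OF * g]]) (rule ext, rule expand)
  next
    fix v
    have "Ck_on k U (\<lambda>x. frechet_derivative f (at x) v)" "\<And>b. Ck_on k V (\<lambda>z. ?Dg z b)"
      using Suc.prems by auto
    then have "Ck_on k U (\<lambda>x. (frechet_derivative f (at x) v \<bullet> b) *\<^sub>R ?Dg (f x) b)" for b
      using Suc.IH[OF Ck_on_SucD[OF Suc.prems(1)], of "\<lambda>z. ?Dg z b"]
      by (intro Ck_on_bilinear[OF bounded_bilinear_scaleR \<open>open U\<close>]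
            Ck_on_linear_compose[OF bounded_linear_inner_left \<open>open U\<close>]) blast+
    then show "Ck_on k U (\<lambda>x. \<Sum>b\<in>Basis. (frechet_derivative f (at x) v \<bullet> b) *\<^sub>R ?Dg (f x) b)"
      by (intro Ck_on_sum \<open>open U\<close>)
  qed
qed

text \<open>On open sets local smooth extensions are just restrictions, so all closure properties of
  \<open>Ck_on\<close> carry over to \<open>smooth_on\<close>.\<close>

lemma smooth_on_open_iff:
  assumes "open U"
  shows "smooth_on U f \<longleftrightarrow> (\<forall>k. Ck_on k U f)"
proof
  assume *: "smooth_on U f"
  show "\<forall>k. Ck_on k U f"
  proof (intro allI Ck_on_local)
    fix k x assume "x \<in> U"
    then obtain V h where V: "open V" "x \<in> V" "\<forall>k. Ck_on k V h" "\<forall>z\<in>U \<inter> V. h z = f z"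
      using * unfolding smooth_on_def by blast
    then have "Ck_on k (U \<inter> V) f"
      using assms by (intro Ck_on_cong[of "U \<inter> V" k h f]) (auto intro: Ck_on_subset)
    then show "\<exists>V. open V \<and> x \<in> V \<and> Ck_on k V f"
      using V assms \<open>x \<in> U\<close> by (intro exI[of _ "U \<inter> V"]) auto
  qed
qed (use assms in \<open>auto simp: smooth_on_def\<close>)

lemma smooth_on_subset: "smooth_on U f \<Longrightarrow> V \<subseteq> U \<Longrightarrow> smooth_on V f"
  unfolding smooth_on_def by (meson Int_mono order_refl subsetD)

lemma smooth_on_cong: "smooth_on U f \<Longrightarrow> (\<And>x. x \<in> U \<Longrightarrow> f x = g x) \<Longrightarrow> smooth_on U g"
  unfolding smooth_on_def by fastforce

lemma smooth_on_local:
  assumes "open U" "\<And>x. x \<in> U \<Longrightarrow> \<exists>V. open V \<and> x \<in> V \<and> smooth_on V f"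
  shows "smooth_on U f"
  unfolding smooth_on_open_iff[OF assms(1)]
  using assms(2) smooth_on_open_iff by (intro allI Ck_on_local) blast

lemma smooth_on_has_derivative:
  "open U \<Longrightarrow> smooth_on U f \<Longrightarrow> x \<in> U \<Longrightarrow> (f has_derivative frechet_derivative f (at x)) (at x)"
  using Ck_on_has_derivative smooth_on_open_iff by blast

lemma smooth_on_imp_continuous_on: "open U \<Longrightarrow> smooth_on U f \<Longrightarrow> continuous_on U f"
  unfolding smooth_on_open_iff by (metis Ck_on.simps(1))

lemma smooth_on_const: "open U \<Longrightarrow> smooth_on U (\<lambda>x. c)"
  by (simp add: smooth_on_open_iff Ck_on_const)

lemma smooth_on_ident: "open U \<Longrightarrow> smooth_on U (\<lambda>x. x)"
  by (simp add: smooth_on_open_iff Ck_on_ident)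

lemma smooth_on_linear_compose:
  "bounded_linear h \<Longrightarrow> open U \<Longrightarrow> smooth_on U f \<Longrightarrow> smooth_on U (\<lambda>x. h (f x))"
  by (simp add: smooth_on_open_iff Ck_on_linear_compose)

lemma smooth_on_add:
  "open U \<Longrightarrow> smooth_on U f \<Longrightarrow> smooth_on U g \<Longrightarrow> smooth_on U (\<lambda>x. f x + g x)"
  by (simp add: smooth_on_open_iff Ck_on_add)

lemma smooth_on_diff:
  "open U \<Longrightarrow> smooth_on U f \<Longrightarrow> smooth_on U g \<Longrightarrow> smooth_on U (\<lambda>x. f x - g x)"
  using smooth_on_add[OF _ _ smooth_on_linear_compose[OF bounded_linear_minus[OF bounded_linear_ident]], of U f g]
  by simp

lemma smooth_on_sum:
  "open U \<Longrightarrow> (\<And>i. i \<in> B \<Longrightarrow> smooth_on U (f i)) \<Longrightarrow> smooth_on U (\<lambda>x. \<Sum>i\<in>B. f i x)"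
  by (simp add: smooth_on_open_iff Ck_on_sum)

lemma smooth_on_bilinear:
  "bounded_bilinear h \<Longrightarrow> open U \<Longrightarrow> smooth_on U f \<Longrightarrow> smooth_on U g \<Longrightarrow>
   smooth_on U (\<lambda>x. h (f x) (g x))"
  by (simp add: smooth_on_open_iff Ck_on_bilinear)

lemma smooth_on_Pair:
  assumes "open U" "smooth_on U f" "smooth_on U g"
  shows "smooth_on U (\<lambda>x. (f x, g x))"
proof -
  have "smooth_on U (\<lambda>x. (f x, 0) + (0, g x))"
    by (intro smooth_on_add smooth_on_linear_compose[where h = "\<lambda>x. (x, 0)"]
          smooth_on_linear_compose[where h = "\<lambda>x. (0, x)"] assms bounded_linear_Pair
          bounded_linear_ident bounded_linear_zero)
  then show ?thesis by simp
qed

lemma smooth_on_compose: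
  fixes f :: "'a::euclidean_space \<Rightarrow> 'b::euclidean_space"
  assumes "open U" "open V" "f ` U \<subseteq> V" "smooth_on U f" "smooth_on V g"
  shows "smooth_on U (\<lambda>x. g (f x))"
  using assms(4,5) Ck_on_compose[OF assms(1-3)]
  unfolding smooth_on_open_iff[OF assms(1)] smooth_on_open_iff[OF assms(2)] by blast

lemma smooth_on_frechet_derivative:
  assumes "open U" "smooth_on U f"
  shows "smooth_on U (\<lambda>x. frechet_derivative f (at x) v)"
  using assms(2) unfolding smooth_on_open_iff[OF assms(1)] by (metis Ck_on.simps(2))

lemma smooth_on_derivative_apply:
  fixes f :: "'a::euclidean_space \<Rightarrow> 'b::euclidean_space" and c u :: "'c::euclidean_space \<Rightarrow> 'a"
  assumes "open J" "open U" "smooth_on U f" "smooth_on J c" "c ` J \<subseteq> U" "smooth_on J u"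
  shows "smooth_on J (\<lambda>t. frechet_derivative f (at (c t)) (u t))"
proof -
  have "smooth_on J (\<lambda>t. \<Sum>b\<in>Basis. (u t \<bullet> b) *\<^sub>R frechet_derivative f (at (c t)) b)"
    using smooth_on_compose[OF assms(1,2,5,4) smooth_on_frechet_derivative[OF assms(2,3)]]
    by (intro smooth_on_sum smooth_on_bilinear[OF bounded_bilinear_scaleR]
          smooth_on_linear_compose[OF bounded_linear_inner_left] assms)
  moreover have "(\<Sum>b\<in>Basis. (u t \<bullet> b) *\<^sub>R frechet_derivative f (at (c t)) b)
      = frechet_derivative f (at (c t)) (u t)" if "t \<in> J" for t
  proof -
    have l: "linear (frechet_derivative f (at (c t)))"
      using smooth_on_has_derivative[OF assms(2,3)] assms(5) that has_derivative_linear by blast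
    show ?thesis
      using linear_sum[OF l, of "\<lambda>b. (u t \<bullet> b) *\<^sub>R b" Basis]
      by (simp add: euclidean_representation linear_scale[OF l])
  qed
  ultimately show ?thesis by (rule smooth_on_cong)
qed

lemma adjoint_eq_sum:
  fixes f :: "'a::euclidean_space \<Rightarrow> 'b::euclidean_space"
  assumes "linear f"
  shows "adjoint f v = (\<Sum>b\<in>Basis. (f b \<bullet> v) *\<^sub>R b)"
  using euclidean_representation[of "adjoint f v"]
  by (simp add: adjoint_works[OF assms] inner_commute)

text \<open>Moving covectors back along a smooth map is smooth in the base point and the covector. This
  is what makes the normal lifts and the parametrisation of \<open>S_CPP\<close> below smooth.\<close>

lemma smooth_on_adjoint_apply:
  fixes f :: "'a::euclidean_space \<Rightarrow> 'b::euclidean_space"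
    and c :: "'c::euclidean_space \<Rightarrow> 'a" and u :: "'c \<Rightarrow> 'b"
  assumes "open J" "open U" "smooth_on U f" "smooth_on J c" "c ` J \<subseteq> U" "smooth_on J u"
  shows "smooth_on J (\<lambda>t. adjoint (frechet_derivative f (at (c t))) (u t))"
proof -
  have "smooth_on J (\<lambda>t. \<Sum>b\<in>Basis. (frechet_derivative f (at (c t)) b \<bullet> u t) *\<^sub>R b)"
    using smooth_on_compose[OF assms(1,2,5,4) smooth_on_frechet_derivative[OF assms(2,3)]]
    by (intro smooth_on_sum smooth_on_linear_compose[OF bounded_linear_scaleR_left]
          smooth_on_bilinear[OF bounded_bilinear_inner] assms)
  moreover have "(\<Sum>b\<in>Basis. (frechet_derivative f (at (c t)) b \<bullet> u t) *\<^sub>R b)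
      = adjoint (frechet_derivative f (at (c t))) (u t)" if "t \<in> J" for t
    using smooth_on_has_derivative[OF assms(2,3)] assms(5) that has_derivative_linear
    by (intro adjoint_eq_sum[symmetric]) blast
  ultimately show ?thesis by (rule smooth_on_cong)
qed

section \<open>Curves, velocities and differentials in product manifolds\<close>

text \<open>The part of being a smooth manifold that velocities depend on: it makes the domain of a curve
  in chart coordinates open, so that the derivative at time 0 is a genuine one.\<close>

definition open_atlas :: "('p::topological_space, 'e) chart set \<Rightarrow> bool" where
  "open_atlas A \<longleftrightarrow> (\<forall>c\<in>A. openin (top_of_set (carrier A)) (fst c))"

lemma open_atlas_smooth_manifold: "smooth_manifold k A \<Longrightarrow> open_atlas A"
  by (auto simp: smooth_manifold_def open_atlas_def is_chart_def)

lemma carrier_euclidean: "carrier euclidean_atlas = UNIV"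
  by (simp add: carrier_def euclidean_atlas_def)

lemma open_atlas_euclidean: "open_atlas euclidean_atlas"
  by (simp add: open_atlas_def carrier_euclidean) (simp add: euclidean_atlas_def)

abbreviation prod_chart :: "('p, 'e) chart \<Rightarrow> ('q, 'f) chart \<Rightarrow> ('p \<times> 'q, 'e \<times> 'f) chart" where
  "prod_chart c d \<equiv> (fst c \<times> fst d, map_prod (snd c) (snd d))"

lemma prod_chart_in_prod_atlas: "c \<in> B \<Longrightarrow> d \<in> A \<Longrightarrow> prod_chart c d \<in> prod_atlas B A"
  unfolding prod_atlas_def by blast

lemma carrier_prod_atlas: "carrier (prod_atlas B A) = carrier B \<times> carrier A"
proof (intro equalityI subsetI)
  fix z assume "z \<in> carrier (prod_atlas B A)"
  then obtain c d where "c \<in> B" "d \<in> A" "z \<in> fst (prod_chart c d)"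
    unfolding carrier_def prod_atlas_def by blast
  then show "z \<in> carrier B \<times> carrier A"
    unfolding carrier_def mem_Times_iff fst_conv by blast
next
  fix z assume "z \<in> carrier B \<times> carrier A"
  then obtain c d where "c \<in> B" "d \<in> A" "z \<in> fst (prod_chart c d)"
    unfolding carrier_def mem_Times_iff fst_conv by blast
  then show "z \<in> carrier (prod_atlas B A)"
    unfolding carrier_def using prod_chart_in_prod_atlas by blast
qed

lemma prod_atlas_cases:
  assumes "c \<in> prod_atlas B A"
  obtains c1 c2 where "c = prod_chart c1 c2" "c1 \<in> B" "c2 \<in> A"
  using assms unfolding prod_atlas_def by blast

lemma open_atlas_prod: "open_atlas B \<Longrightarrow> open_atlas A \<Longrightarrow> open_atlas (prod_atlas B A)"
  unfolding open_atlas_def carrier_prod_atlas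
  by (metis prod_atlas_cases fst_conv openin_Times)

lemma curves_mono: "S \<subseteq> S' \<Longrightarrow> curves A S p \<subseteq> curves A S' p"
  unfolding curves_def by blast

lemma curves_start: "\<gamma> \<in> curves A S p \<Longrightarrow> \<gamma> 0 = p"
  by (simp add: curves_def)

lemma curves_start_in: "\<gamma> \<in> curves A S p \<Longrightarrow> p \<in> S"
  by (force simp: curves_def)

lemma curvesE:
  assumes "\<gamma> \<in> curves A S p"
  obtains \<epsilon> where "\<epsilon> > 0" "\<gamma> 0 = p" "\<gamma> ` {-\<epsilon><..<\<epsilon>} \<subseteq> S" "continuous_on {-\<epsilon><..<\<epsilon>} \<gamma>"
    "\<And>c. c \<in> A \<Longrightarrow> smooth_on ({-\<epsilon><..<\<epsilon>} \<inter> \<gamma> -` fst c) (snd c \<circ> \<gamma>)"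
  using assms unfolding curves_def by blast

lemma open_curve_vimage:
  fixes \<gamma> :: "'a::topological_space \<Rightarrow> 'p::topological_space"
  assumes "openin (top_of_set M) D" "open J" "continuous_on J \<gamma>" "\<gamma> ` J \<subseteq> M"
  shows "open (J \<inter> \<gamma> -` D)"
proof -
  have "openin (top_of_set J) (J \<inter> \<gamma> -` D)"
    by (rule continuous_openin_preimage[OF assms(3) _ assms(1)]) (use assms(4) in auto)
  then show ?thesis using assms(2) by (simp add: openin_open_eq)
qed

lemma curves_image_subset:
  assumes "\<gamma> \<in> curves A S p" "\<delta> > 0" "\<gamma> ` {-\<delta><..<\<delta>} \<subseteq> S'"
  shows "\<gamma> \<in> curves A S' p"
proof -
  obtain \<epsilon> where \<epsilon>: "\<epsilon> > 0" "\<gamma> 0 = p" "\<gamma> ` {-\<epsilon><..<\<epsilon>} \<subseteq> S" "continuous_on {-\<epsilon><..<\<epsilon>} \<gamma>"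
    "\<And>c. c \<in> A \<Longrightarrow> smooth_on ({-\<epsilon><..<\<epsilon>} \<inter> \<gamma> -` fst c) (snd c \<circ> \<gamma>)"
    using curvesE[OF assms(1)] by blast
  let ?e = "min \<delta> \<epsilon>"
  have sub: "{-?e<..<?e} \<subseteq> {-\<epsilon><..<\<epsilon>}" "{-?e<..<?e} \<subseteq> {-\<delta><..<\<delta>}" by auto
  have "smooth_on ({-?e<..<?e} \<inter> \<gamma> -` fst c) (snd c \<circ> \<gamma>)" if "c \<in> A" for c
    by (rule smooth_on_subset[OF \<epsilon>(5)[OF that]]) (use sub in auto)
  moreover have "continuous_on {-?e<..<?e} \<gamma>" using \<epsilon>(4) sub(1) by (rule continuous_on_subset)
  moreover have "\<gamma> ` {-?e<..<?e} \<subseteq> S'" using assms(3) sub(2) by blast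
  moreover have "?e > 0" using assms(2) \<epsilon>(1) by simp
  ultimately show ?thesis using \<epsilon>(2) unfolding curves_def by blast
qed

text \<open>By continuity a curve remains for a short time in every relatively open set that contains its
  starting point. This is how openness of the well-posed loci enters.\<close>

lemma curves_restrict:
  assumes "\<gamma> \<in> curves A S p" "openin (top_of_set S) S'" "p \<in> S'"
  shows "\<gamma> \<in> curves A S' p"
proof -
  obtain \<epsilon> where \<epsilon>: "\<epsilon> > 0" "\<gamma> 0 = p" "\<gamma> ` {-\<epsilon><..<\<epsilon>} \<subseteq> S" "continuous_on {-\<epsilon><..<\<epsilon>} \<gamma>"
    using curvesE[OF assms(1)] by blast
  have "open ({-\<epsilon><..<\<epsilon>} \<inter> \<gamma> -` S')"
    by (rule open_curve_vimage[OF assms(2) _ \<epsilon>(4,3)]) simp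
  moreover have "0 \<in> {-\<epsilon><..<\<epsilon>} \<inter> \<gamma> -` S'" using \<epsilon>(1,2) assms(3) by simp
  ultimately obtain e where e: "e > 0" "{0-e<..<0+e} \<subseteq> {-\<epsilon><..<\<epsilon>} \<inter> \<gamma> -` S'"
    by (metis ball_eq_greaterThanLessThan openE)
  then show ?thesis by (intro curves_image_subset[OF assms(1) e(1)]) auto
qed

lemma const_in_curves: "p \<in> S \<Longrightarrow> (\<lambda>t. p) \<in> curves A S p"
  using smooth_on_subset[OF smooth_on_const[OF open_UNIV] subset_UNIV]
  by (auto simp: curves_def o_def intro!: exI[of _ 1])

lemma velocity_const: "velocity A (\<lambda>t. p) = (\<lambda>c. 0)"
  by (auto simp: velocity_def o_def)

lemma velocity_has_derivative:
  fixes A :: "('p::topological_space, 'e::euclidean_space) chart set"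
  assumes "open_atlas A" "\<gamma> \<in> curves A S p" "S \<subseteq> carrier A" "c \<in> A" "p \<in> fst c"
  shows "((snd c \<circ> \<gamma>) has_vector_derivative velocity A \<gamma> c) (at 0)"
proof -
  obtain \<epsilon> where \<epsilon>: "\<epsilon> > 0" "\<gamma> ` {-\<epsilon><..<\<epsilon>} \<subseteq> S" "continuous_on {-\<epsilon><..<\<epsilon>} \<gamma>"
    "smooth_on ({-\<epsilon><..<\<epsilon>} \<inter> \<gamma> -` fst c) (snd c \<circ> \<gamma>)" and 0: "\<gamma> 0 = p"
    using assms(2,4) by (auto simp: curves_def)
  have "open ({-\<epsilon><..<\<epsilon>} \<inter> \<gamma> -` fst c)"
    using assms(1,3,4) \<epsilon>(2)
    by (intro open_curve_vimage[where M = "carrier A", OF _ _ \<epsilon>(3)]) (auto simp: open_atlas_def)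
  from smooth_on_has_derivative[OF this \<epsilon>(4), of 0] have "(snd c \<circ> \<gamma>) differentiable (at 0)"
    using \<epsilon>(1) 0 assms(5) by (auto simp: differentiable_def)
  then show ?thesis
    using 0 assms(4,5) by (simp add: velocity_def vector_derivative_works)
qed

text \<open>Smoothness of a component in a chart of its own factor has to be tested on a domain that is not
  the domain of one product chart. Near each time it is contained in such a domain, because some
  chart of the other factor covers the other component; smoothness is local.\<close>

lemma curves_prod_atlas_iff:
  fixes B :: "('p::topological_space, 'e::euclidean_space) chart set"
    and A :: "('q::topological_space, 'f::euclidean_space) chart set"
  assumes "open_atlas B" "open_atlas A" "S \<subseteq> carrier B \<times> carrier A"
  shows "\<gamma> \<in> curves (prod_atlas B A) S p \<longleftrightarrow>
    fst \<circ> \<gamma> \<in> curves B (carrier B) (fst p) \<and> snd \<circ> \<gamma> \<in> curves A (carrier A) (snd p) \<and>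
    (\<exists>\<epsilon>>0. \<gamma> ` {-\<epsilon><..<\<epsilon>} \<subseteq> S)"
proof (intro iffI conjI)
  assume "\<gamma> \<in> curves (prod_atlas B A) S p"
  then obtain \<epsilon> where \<epsilon>: "\<epsilon> > 0" "\<gamma> ` {-\<epsilon><..<\<epsilon>} \<subseteq> S" "continuous_on {-\<epsilon><..<\<epsilon>} \<gamma>"
    "\<And>c d. c \<in> B \<Longrightarrow> d \<in> A \<Longrightarrow>
       smooth_on ({-\<epsilon><..<\<epsilon>} \<inter> \<gamma> -` (fst c \<times> fst d)) (map_prod (snd c) (snd d) \<circ> \<gamma>)"
    and 0: "\<gamma> 0 = p"
    unfolding curves_def using prod_chart_in_prod_atlas by fastforce
  show "\<exists>\<epsilon>>0. \<gamma> ` {-\<epsilon><..<\<epsilon>} \<subseteq> S" using \<epsilon> by blast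
  have cont: "continuous_on {-\<epsilon><..<\<epsilon>} (fst \<circ> \<gamma>)" "continuous_on {-\<epsilon><..<\<epsilon>} (snd \<circ> \<gamma>)"
    using \<epsilon>(3) by (auto intro!: continuous_on_compose continuous_intros)
  have img: "fst (\<gamma> t) \<in> carrier B" "snd (\<gamma> t) \<in> carrier A" if "t \<in> {-\<epsilon><..<\<epsilon>}" for t
  proof -
    have "\<gamma> t \<in> carrier B \<times> carrier A" using that \<epsilon>(2) assms(3) by blast
    then show "fst (\<gamma> t) \<in> carrier B" "snd (\<gamma> t) \<in> carrier A" by auto
  qed
  have openB: "open ({-\<epsilon><..<\<epsilon>} \<inter> (fst \<circ> \<gamma>) -` fst c)" if "c \<in> B" for c
    using assms(1) that img by (intro open_curve_vimage[where M = "carrier B", OF _ _ cont(1)]) (auto simp: open_atlas_def)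
  have openA: "open ({-\<epsilon><..<\<epsilon>} \<inter> (snd \<circ> \<gamma>) -` fst d)" if "d \<in> A" for d
    using assms(2) that img by (intro open_curve_vimage[where M = "carrier A", OF _ _ cont(2)]) (auto simp: open_atlas_def)
  have rect: "({-\<epsilon><..<\<epsilon>} \<inter> (fst \<circ> \<gamma>) -` fst c) \<inter> ({-\<epsilon><..<\<epsilon>} \<inter> (snd \<circ> \<gamma>) -` fst d)
      = {-\<epsilon><..<\<epsilon>} \<inter> \<gamma> -` (fst c \<times> fst d)" for c :: "('p, 'e) chart" and d :: "('q, 'f) chart"
    by (auto simp: mem_Times_iff)
  have openR: "open ({-\<epsilon><..<\<epsilon>} \<inter> \<gamma> -` (fst c \<times> fst d))" if "c \<in> B" "d \<in> A" for c d
    unfolding rect[symmetric] by (intro open_Int openA openB that)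
  have "smooth_on ({-\<epsilon><..<\<epsilon>} \<inter> (fst \<circ> \<gamma>) -` fst c) (snd c \<circ> (fst \<circ> \<gamma>))" if c: "c \<in> B" for c
  proof (rule smooth_on_local[OF openB[OF c]])
    fix t assume t: "t \<in> {-\<epsilon><..<\<epsilon>} \<inter> (fst \<circ> \<gamma>) -` fst c"
    then obtain d where d: "d \<in> A" "snd (\<gamma> t) \<in> fst d" 
      using img by (metis IntD1 UN_E carrier_def)
    have "smooth_on ({-\<epsilon><..<\<epsilon>} \<inter> \<gamma> -` (fst c \<times> fst d)) (snd c \<circ> (fst \<circ> \<gamma>))"
      using smooth_on_linear_compose[OF bounded_linear_fst openR[OF c d(1)] \<epsilon>(4)[OF c d(1)]]
      by (simp add: o_def)
    then show "\<exists>V. open V \<and> t \<in> V \<and> smooth_on V (snd c \<circ> (fst \<circ> \<gamma>))"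
      using openR[OF c d(1)] t d(2) by (intro exI[of _ "{-\<epsilon><..<\<epsilon>} \<inter> \<gamma> -` (fst c \<times> fst d)"]) (auto simp: mem_Times_iff)
  qed
  then show "fst \<circ> \<gamma> \<in> curves B (carrier B) (fst p)"
    using 0 \<epsilon>(1) cont(1) img by (auto simp: curves_def image_subset_iff intro!: exI[of _ \<epsilon>])
  have "smooth_on ({-\<epsilon><..<\<epsilon>} \<inter> (snd \<circ> \<gamma>) -` fst d) (snd d \<circ> (snd \<circ> \<gamma>))" if d: "d \<in> A" for d
  proof (rule smooth_on_local[OF openA[OF d]])
    fix t assume t: "t \<in> {-\<epsilon><..<\<epsilon>} \<inter> (snd \<circ> \<gamma>) -` fst d"
    then obtain c where c: "c \<in> B" "fst (\<gamma> t) \<in> fst c" 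
      using img by (metis IntD1 UN_E carrier_def)
    have "smooth_on ({-\<epsilon><..<\<epsilon>} \<inter> \<gamma> -` (fst c \<times> fst d)) (snd d \<circ> (snd \<circ> \<gamma>))"
      using smooth_on_linear_compose[OF bounded_linear_snd openR[OF c(1) d] \<epsilon>(4)[OF c(1) d]]
      by (simp add: o_def)
    then show "\<exists>V. open V \<and> t \<in> V \<and> smooth_on V (snd d \<circ> (snd \<circ> \<gamma>))"
      using openR[OF c(1) d] t c(2) by (intro exI[of _ "{-\<epsilon><..<\<epsilon>} \<inter> \<gamma> -` (fst c \<times> fst d)"]) (auto simp: mem_Times_iff)
  qed
  then show "snd \<circ> \<gamma> \<in> curves A (carrier A) (snd p)"
    using 0 \<epsilon>(1) cont(2) img by (auto simp: curves_def image_subset_iff intro!: exI[of _ \<epsilon>])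
next
  assume *: "fst \<circ> \<gamma> \<in> curves B (carrier B) (fst p) \<and> snd \<circ> \<gamma> \<in> curves A (carrier A) (snd p) \<and>
    (\<exists>\<epsilon>>0. \<gamma> ` {-\<epsilon><..<\<epsilon>} \<subseteq> S)"
  then obtain \<epsilon>\<^sub>1 where 1: "\<epsilon>\<^sub>1 > 0" "(fst \<circ> \<gamma>) 0 = fst p"
    "(fst \<circ> \<gamma>) ` {-\<epsilon>\<^sub>1<..<\<epsilon>\<^sub>1} \<subseteq> carrier B" "continuous_on {-\<epsilon>\<^sub>1<..<\<epsilon>\<^sub>1} (fst \<circ> \<gamma>)"
    "\<And>c. c \<in> B \<Longrightarrow> smooth_on ({-\<epsilon>\<^sub>1<..<\<epsilon>\<^sub>1} \<inter> (fst \<circ> \<gamma>) -` fst c) (snd c \<circ> (fst \<circ> \<gamma>))"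
    using curvesE by blast
  from * obtain \<epsilon>\<^sub>2 where 2: "\<epsilon>\<^sub>2 > 0" "(snd \<circ> \<gamma>) 0 = snd p"
    "(snd \<circ> \<gamma>) ` {-\<epsilon>\<^sub>2<..<\<epsilon>\<^sub>2} \<subseteq> carrier A" "continuous_on {-\<epsilon>\<^sub>2<..<\<epsilon>\<^sub>2} (snd \<circ> \<gamma>)"
    "\<And>d. d \<in> A \<Longrightarrow> smooth_on ({-\<epsilon>\<^sub>2<..<\<epsilon>\<^sub>2} \<inter> (snd \<circ> \<gamma>) -` fst d) (snd d \<circ> (snd \<circ> \<gamma>))"
    using curvesE by blast
  from * obtain \<epsilon>\<^sub>3 where 3: "\<epsilon>\<^sub>3 > 0" "\<gamma> ` {-\<epsilon>\<^sub>3<..<\<epsilon>\<^sub>3} \<subseteq> S" by blast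
  define \<epsilon> where "\<epsilon> = min \<epsilon>\<^sub>1 (min \<epsilon>\<^sub>2 \<epsilon>\<^sub>3)"
  have sub: "{-\<epsilon><..<\<epsilon>} \<subseteq> {-\<epsilon>\<^sub>1<..<\<epsilon>\<^sub>1}" "{-\<epsilon><..<\<epsilon>} \<subseteq> {-\<epsilon>\<^sub>2<..<\<epsilon>\<^sub>2}" "{-\<epsilon><..<\<epsilon>} \<subseteq> {-\<epsilon>\<^sub>3<..<\<epsilon>\<^sub>3}"
    by (auto simp: \<epsilon>_def)
  note cont = continuous_on_subset[OF 1(4) sub(1)] continuous_on_subset[OF 2(4) sub(2)]
  have "continuous_on {-\<epsilon><..<\<epsilon>} \<gamma>"
    using continuous_on_Pair[OF cont] by (simp add: o_def)
  moreover have "smooth_on ({-\<epsilon><..<\<epsilon>} \<inter> \<gamma> -` fst c) (snd c \<circ> \<gamma>)" if "c \<in> prod_atlas B A" for c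
  proof -
    obtain c1 c2 where c: "c = prod_chart c1 c2" "c1 \<in> B" "c2 \<in> A"
      using \<open>c \<in> prod_atlas B A\<close> by (rule prod_atlas_cases)
    have "open ({-\<epsilon><..<\<epsilon>} \<inter> (fst \<circ> \<gamma>) -` fst c1)"
      using assms(1) c(2) 1(3) sub(1)
      by (intro open_curve_vimage[where M = "carrier B", OF _ _ cont(1)]) (auto simp: open_atlas_def)
    moreover have "open ({-\<epsilon><..<\<epsilon>} \<inter> (snd \<circ> \<gamma>) -` fst c2)"
      using assms(2) c(3) 2(3) sub(2)
      by (intro open_curve_vimage[where M = "carrier A", OF _ _ cont(2)]) (auto simp: open_atlas_def)
    ultimately have "open (({-\<epsilon><..<\<epsilon>} \<inter> (fst \<circ> \<gamma>) -` fst c1) \<inter> ({-\<epsilon><..<\<epsilon>} \<inter> (snd \<circ> \<gamma>) -` fst c2))"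
      by blast
    also have "\<dots> = {-\<epsilon><..<\<epsilon>} \<inter> \<gamma> -` fst c" by (auto simp: c(1) mem_Times_iff)
    finally have "smooth_on ({-\<epsilon><..<\<epsilon>} \<inter> \<gamma> -` fst c) (\<lambda>t. ((snd c1 \<circ> (fst \<circ> \<gamma>)) t, (snd c2 \<circ> (snd \<circ> \<gamma>)) t))"
      by (rule smooth_on_Pair[OF _ smooth_on_subset[OF 1(5)[OF c(2)]] smooth_on_subset[OF 2(5)[OF c(3)]]])
        (use sub in \<open>auto simp: c(1) mem_Times_iff\<close>)
    then show ?thesis by (simp add: c(1) o_def map_prod_def case_prod_beta)
  qed
  moreover have "\<gamma> 0 = p" using 1(2) 2(2) by (simp add: prod_eq_iff)
  moreover have "\<epsilon> > 0" using 1 2 3 by (simp add: \<epsilon>_def)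
  moreover have "\<gamma> ` {-\<epsilon><..<\<epsilon>} \<subseteq> S" using 3 sub by blast
  ultimately show "\<gamma> \<in> curves (prod_atlas B A) S p" unfolding curves_def by blast
qed

lemma velocity_prod_chart:
  fixes B :: "('p::topological_space, 'e::euclidean_space) chart set"
    and A :: "('q::topological_space, 'f::euclidean_space) chart set"
  assumes "open_atlas B" "open_atlas A" "S \<subseteq> carrier B \<times> carrier A"
    and \<gamma>: "\<gamma> \<in> curves (prod_atlas B A) S p"
    and "c \<in> B" "d \<in> A" "fst p \<in> fst c" "snd p \<in> fst d"
  shows "velocity (prod_atlas B A) \<gamma> (prod_chart c d)
       = (velocity B (fst \<circ> \<gamma>) c, velocity A (snd \<circ> \<gamma>) d)"
proof -
  have "fst \<circ> \<gamma> \<in> curves B (carrier B) (fst p)" "snd \<circ> \<gamma> \<in> curves A (carrier A) (snd p)"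
    using \<gamma> curves_prod_atlas_iff[OF assms(1-3)] by blast+
  then have "((\<lambda>t. ((snd c \<circ> (fst \<circ> \<gamma>)) t, (snd d \<circ> (snd \<circ> \<gamma>)) t)) has_vector_derivative
      (velocity B (fst \<circ> \<gamma>) c, velocity A (snd \<circ> \<gamma>) d)) (at 0)"
    using assms(5-) unfolding has_vector_derivative_def scaleR_Pair
    by (intro has_derivative_Pair velocity_has_derivative[unfolded has_vector_derivative_def]
          assms(1,2)) auto
  moreover have "snd (prod_chart c d) \<circ> \<gamma> = (\<lambda>t. ((snd c \<circ> (fst \<circ> \<gamma>)) t, (snd d \<circ> (snd \<circ> \<gamma>)) t))"
    by (auto simp: fun_eq_iff map_prod_def case_prod_beta)
  ultimately show ?thesis
    using assms(5-) prod_chart_in_prod_atlas[OF assms(5,6)] curves_start[OF \<gamma>]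
    by (simp add: velocity_def vector_derivative_at mem_Times_iff)
qed

text \<open>A tangent vector of the product carries the same information as its two components, although
  it is a family indexed by product charts. All injectivity statements below go through this.\<close>

lemma velocity_prod_atlas_eq_iff:
  fixes B :: "('p::topological_space, 'e::euclidean_space) chart set"
    and A :: "('q::topological_space, 'f::euclidean_space) chart set"
  assumes "open_atlas B" "open_atlas A" "S \<subseteq> carrier B \<times> carrier A"
    and \<gamma>: "\<gamma> \<in> curves (prod_atlas B A) S p" and \<delta>: "\<delta> \<in> curves (prod_atlas B A) S p"
  shows "velocity (prod_atlas B A) \<gamma> = velocity (prod_atlas B A) \<delta> \<longleftrightarrow>
    velocity B (fst \<circ> \<gamma>) = velocity B (fst \<circ> \<delta>) \<and> velocity A (snd \<circ> \<gamma>) = velocity A (snd \<circ> \<delta>)"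
proof -
  note v = velocity_prod_chart[OF assms(1-3)]
  have p: "fst p \<in> carrier B" "snd p \<in> carrier A"
    using curves_start_in[OF \<gamma>] assms(3) by auto
  then obtain c0 d0 where 0: "c0 \<in> B" "fst p \<in> fst c0" "d0 \<in> A" "snd p \<in> fst d0"
    by (metis UN_E carrier_def)
  have s: "\<gamma> 0 = p" "\<delta> 0 = p" using \<gamma> \<delta> by (auto dest: curves_start)
  show ?thesis
  proof (intro iffI conjI ext)
    fix c assume eq: "velocity (prod_atlas B A) \<gamma> = velocity (prod_atlas B A) \<delta>"
    show "velocity B (fst \<circ> \<gamma>) c = velocity B (fst \<circ> \<delta>) c"
    proof (cases "c \<in> B \<and> fst p \<in> fst c")
      case True
      then show ?thesis using v[OF \<gamma>, of c d0] v[OF \<delta>, of c d0] 0 eq by simp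
    next
      case False
      then show ?thesis by (auto simp: velocity_def s)
    qed
  next
    fix d assume eq: "velocity (prod_atlas B A) \<gamma> = velocity (prod_atlas B A) \<delta>"
    show "velocity A (snd \<circ> \<gamma>) d = velocity A (snd \<circ> \<delta>) d"
    proof (cases "d \<in> A \<and> snd p \<in> fst d")
      case True
      then show ?thesis using v[OF \<gamma>, of c0 d] v[OF \<delta>, of c0 d] 0 eq by simp
    next
      case False
      then show ?thesis by (auto simp: velocity_def s)
    qed
  next
    fix c
    assume eq: "velocity B (fst \<circ> \<gamma>) = velocity B (fst \<circ> \<delta>) \<and> velocity A (snd \<circ> \<gamma>) = velocity A (snd \<circ> \<delta>)"
    show "velocity (prod_atlas B A) \<gamma> c = velocity (prod_atlas B A) \<delta> c"
    proof (cases "c \<in> prod_atlas B A \<and> p \<in> fst c")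
      case True
      then obtain c1 c2 where "c = prod_chart c1 c2" "c1 \<in> B" "c2 \<in> A" "fst p \<in> fst c1" "snd p \<in> fst c2"
        by (metis prod_atlas_cases fst_conv mem_Times_iff)
      then show ?thesis using v[OF \<gamma>, of c1 c2] v[OF \<delta>, of c1 c2] eq by simp
    next
      case False
      then show ?thesis by (auto simp: velocity_def s)
    qed
  qed
qed

text \<open>The differential is defined through an arbitrary curve with the given velocity. Its value can be
  read off from any curve as soon as the velocity of \<open>F \<circ> \<delta>\<close> depends on the velocity of \<open>\<delta>\<close> only.\<close>

lemma differential_velocity:
  assumes "\<gamma> \<in> curves A S p"
    and "\<And>\<delta>. \<delta> \<in> curves A S p \<Longrightarrow> velocity A \<delta> = velocity A \<gamma> \<Longrightarrow>
           velocity B (F \<circ> \<delta>) = velocity B (F \<circ> \<gamma>)"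
  shows "differential A S B F p (velocity A \<gamma>) = velocity B (F \<circ> \<gamma>)"
proof -
  let ?P = "\<lambda>\<delta>. \<delta> \<in> curves A S p \<and> velocity A \<delta> = velocity A \<gamma>"
  have "?P (SOME \<delta>. ?P \<delta>)" by (rule someI[of ?P \<gamma>]) (use assms(1) in simp)
  then show ?thesis using assms(2) unfolding differential_def by blast
qed

lemma differential_fst:
  fixes B :: "('p::topological_space, 'e::euclidean_space) chart set"
    and A :: "('q::topological_space, 'f::euclidean_space) chart set"
  assumes "open_atlas B" "open_atlas A" "S \<subseteq> carrier B \<times> carrier A"
    "\<gamma> \<in> curves (prod_atlas B A) S p"
  shows "differential (prod_atlas B A) S B fst p (velocity (prod_atlas B A) \<gamma>) = velocity B (fst \<circ> \<gamma>)"
  using velocity_prod_atlas_eq_iff[OF assms(1-3) _ assms(4)]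
  by (intro differential_velocity assms(4)) blast

lemma differential_snd:
  fixes B :: "('p::topological_space, 'e::euclidean_space) chart set"
    and A :: "('q::topological_space, 'f::euclidean_space) chart set"
  assumes "open_atlas B" "open_atlas A" "S \<subseteq> carrier B \<times> carrier A"
    "\<gamma> \<in> curves (prod_atlas B A) S p"
  shows "differential (prod_atlas B A) S A snd p (velocity (prod_atlas B A) \<gamma>) = velocity A (snd \<circ> \<gamma>)"
  using velocity_prod_atlas_eq_iff[OF assms(1-3) _ assms(4)]
  by (intro differential_velocity assms(4)) blast

lemma curves_euclidean_iff:
  "\<gamma> \<in> curves euclidean_atlas M x \<longleftrightarrow>
     \<gamma> 0 = x \<and> (\<exists>\<epsilon>>0. \<gamma> ` {-\<epsilon><..<\<epsilon>} \<subseteq> M \<and> smooth_on {-\<epsilon><..<\<epsilon>} \<gamma>)"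
  using smooth_on_imp_continuous_on[OF open_greaterThanLessThan, of "-\<epsilon>" \<epsilon> \<gamma> for \<epsilon>]
  by (auto simp: curves_def euclidean_atlas_def)

lemma velocity_euclidean:
  fixes \<gamma> :: "real \<Rightarrow> 'a::euclidean_space"
  shows "velocity euclidean_atlas \<gamma>
    = (\<lambda>c. if c = (UNIV, id) then vector_derivative \<gamma> (at 0) else 0)"
proof
  fix c :: "('a, 'a) chart"
  show "velocity euclidean_atlas \<gamma> c = (if c = (UNIV, id) then vector_derivative \<gamma> (at 0) else 0)"
    by (cases "c = (UNIV, id)") (simp_all add: velocity_def euclidean_atlas_def)
qed

lemma to_vec_velocity: "to_vec (velocity euclidean_atlas \<gamma>) = vector_derivative \<gamma> (at 0)"
  by (simp add: to_vec_def velocity_euclidean)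

lemma velocity_euclidean_eq_iff:
  "velocity euclidean_atlas \<gamma> = velocity euclidean_atlas \<delta> \<longleftrightarrow>
   vector_derivative \<gamma> (at 0) = vector_derivative \<delta> (at 0)"
proof
  assume "velocity euclidean_atlas \<gamma> = velocity euclidean_atlas \<delta>"
  from arg_cong[OF this, of to_vec]
  show "vector_derivative \<gamma> (at 0) = vector_derivative \<delta> (at 0)" by (simp add: to_vec_velocity)
qed (simp only: velocity_euclidean)

lemma curves_euclidean_derivative:
  fixes \<gamma> :: "real \<Rightarrow> 'a::euclidean_space"
  assumes "\<gamma> \<in> curves euclidean_atlas M x"
  shows "(\<gamma> has_vector_derivative vector_derivative \<gamma> (at 0)) (at 0)"
proof -
  have "((snd (UNIV :: 'a set, id) \<circ> \<gamma>) has_vector_derivative velocity euclidean_atlas \<gamma> (UNIV, id)) (at 0)"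
    by (rule velocity_has_derivative[OF open_atlas_euclidean assms])
       (simp_all add: carrier_euclidean, simp add: euclidean_atlas_def)
  then show ?thesis
    using to_vec_velocity[of \<gamma>] by (simp add: to_vec_def)
qed

lemma tangent_eq: "tangent M x = (\<lambda>\<gamma>. vector_derivative \<gamma> (at 0)) ` curves euclidean_atlas M x"
  by (simp add: tangent_def tangent_space_def image_image to_vec_velocity)

section \<open>Orthogonal projection\<close>

definition orth_proj :: "'a::euclidean_space set \<Rightarrow> 'a \<Rightarrow> 'a" where
  "orth_proj T u = (THE v. v \<in> T \<and> (\<forall>w\<in>T. (u - v) \<bullet> w = 0))"

lemma orth_proj_unique:
  assumes "subspace T" "v \<in> T" "\<And>w. w \<in> T \<Longrightarrow> (u - v) \<bullet> w = 0"
  shows "orth_proj T u = v"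
  unfolding orth_proj_def
proof (rule the_equality)
  fix v' assume v': "v' \<in> T \<and> (\<forall>w\<in>T. (u - v') \<bullet> w = 0)"
  then have "v' - v \<in> T" using assms by (simp add: subspace_diff)
  then have "(u - v) \<bullet> (v' - v) - (u - v') \<bullet> (v' - v) = 0" using assms(3) v' by simp
  then have "(v' - v) \<bullet> (v' - v) = 0" by (simp add: algebra_simps)
  then show "v' = v" by simp
qed (use assms in auto)

lemma
  assumes "subspace T"
  shows orth_proj_in: "orth_proj T u \<in> T"
    and orth_proj_orthogonal: "w \<in> T \<Longrightarrow> (u - orth_proj T u) \<bullet> w = 0"
proof -
  obtain v z where "v \<in> span T" "\<And>w. w \<in> span T \<Longrightarrow> orthogonal z w" "u = v + z"
    using orthogonal_subspace_decomp_exists by blast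
  then have v: "v \<in> T" "\<And>w. w \<in> T \<Longrightarrow> (u - v) \<bullet> w = 0"
    using span_eq_iff[THEN iffD2, OF assms] by (auto simp: orthogonal_def)
  with orth_proj_unique[OF assms this] show "orth_proj T u \<in> T" "w \<in> T \<Longrightarrow> (u - orth_proj T u) \<bullet> w = 0"
    by auto
qed

lemma orth_proj_id: "subspace T \<Longrightarrow> u \<in> T \<Longrightarrow> orth_proj T u = u"
  by (rule orth_proj_unique) auto

lemma linear_orth_proj:
  assumes "subspace T"
  shows "linear (orth_proj T)"
proof
  fix u v and r :: real
  note P = orth_proj_in[OF assms] orth_proj_orthogonal[OF assms]
  show "orth_proj T (u + v) = orth_proj T u + orth_proj T v"
  proof (rule orth_proj_unique[OF assms])
    fix w assume "w \<in> T"
    then have "(u - orth_proj T u) \<bullet> w + (v - orth_proj T v) \<bullet> w = 0" using P by simp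
    then show "(u + v - (orth_proj T u + orth_proj T v)) \<bullet> w = 0" by (simp add: algebra_simps)
  qed (use P assms in \<open>simp add: subspace_add\<close>)
  show "orth_proj T (r *\<^sub>R u) = r *\<^sub>R orth_proj T u"
    using P assms
    by (intro orth_proj_unique) (auto simp: subspace_scale simp flip: scaleR_diff_right)
qed

lemma norm_orth_proj_le:
  assumes "subspace T"
  shows "norm (orth_proj T u) \<le> norm u"
proof -
  have "(u - orth_proj T u) \<bullet> orth_proj T u = 0"
    using orth_proj_orthogonal[OF assms orth_proj_in[OF assms]] .
  then have "(norm (orth_proj T u))\<^sup>2 = u \<bullet> orth_proj T u"
    by (simp add: power2_norm_eq_inner inner_diff_left)
  also have "\<dots> \<le> norm u * norm (orth_proj T u)" by (rule norm_cauchy_schwarz)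
  finally show ?thesis
    by (metis mult_le_cancel_right norm_ge_zero norm_le_zero_iff order_trans power2_eq_square not_le)
qed

lemma normal_iff: "\<nu> \<in> normal I x \<longleftrightarrow> (\<forall>w\<in>tangent I x. \<nu> \<bullet> w = 0)"
  by (auto simp: normal_def orthogonal_comp_def orthogonal_def inner_commute)

text \<open>Only the pairing of the second fundamental form with a normal vector enters the Weingarten map,
  and there the projection to the normal space can be dropped.\<close>

lemma normal_part_inner:
  assumes "subspace (tangent I x)" "\<eta> \<in> normal I x"
  shows "normal_part I x u \<bullet> \<eta> = u \<bullet> \<eta>"
proof -
  let ?T = "tangent I x"
  have "normal_part I x u = u - orth_proj ?T u"
    unfolding normal_part_def
  proof (rule the_equality)
    show "u - orth_proj ?T u \<in> normal I x \<and> u - (u - orth_proj ?T u) \<in> ?T"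
      using orth_proj_in orth_proj_orthogonal assms(1) by (auto simp: normal_iff)
  next
    fix \<nu> assume "\<nu> \<in> normal I x \<and> u - \<nu> \<in> ?T"
    then have "orth_proj ?T u = u - \<nu>" by (intro orth_proj_unique assms(1)) (auto simp: normal_iff)
    then show "\<nu> = u - orth_proj ?T u" by simp
  qed
  moreover have "orth_proj ?T u \<bullet> \<eta> = 0"
    using assms(2) orth_proj_in[OF assms(1)] unfolding normal_iff by (metis inner_commute)
  ultimately show ?thesis by (simp add: inner_diff_left)
qed

section \<open>Flattening an embedded submanifold of Euclidean space\<close>

lemma has_vector_derivative_imp_quotient_tendsto:
  assumes "(f has_vector_derivative v) (at 0)"
  shows "((\<lambda>t. (f t - f 0) /\<^sub>R t) \<longlongrightarrow> v) (at 0)"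
proof -
  have "((\<lambda>t. norm (f (0 + t) - f 0 - t *\<^sub>R v) / norm t) \<longlongrightarrow> 0) (at 0)"
    using assms by (simp add: has_vector_derivative_def has_derivative_at)
  moreover have "\<forall>\<^sub>F t in at 0. norm (f (0 + t) - f 0 - t *\<^sub>R v) / norm t = norm ((f t - f 0) /\<^sub>R t - v)"
  proof (rule eventually_at_filter[THEN iffD2], intro always_eventually allI impI)
    fix t :: real assume "t \<noteq> 0"
    then have "(f t - f 0) /\<^sub>R t - v = (f t - f 0 - t *\<^sub>R v) /\<^sub>R t" by (simp add: algebra_simps)
    then show "norm (f (0 + t) - f 0 - t *\<^sub>R v) / norm t = norm ((f t - f 0) /\<^sub>R t - v)"
      by (simp add: divide_inverse_commute)
  qed
  ultimately have "((\<lambda>t. norm ((f t - f 0) /\<^sub>R t - v)) \<longlongrightarrow> 0) (at 0)"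
    by (rule Lim_transform_eventually)
  then show ?thesis by (rule LIM_zero_cancel[OF tendsto_norm_zero_cancel])
qed

text \<open>A slice chart of \<open>I\<close>, stripped of the manifold vocabulary: a diffeomorphism \<open>\<phi>\<close> with inverse \<open>\<psi>\<close>
  between open subsets of the ambient space that maps the part of \<open>I\<close> in \<open>U\<close> to the linear subspace \<open>L\<close>.\<close>

locale flattening =
  fixes I U :: "'a::euclidean_space set" and \<phi> \<psi> :: "'a \<Rightarrow> 'a" and L :: "'a set"
  assumes open_U: "open U" and open_V: "open (\<phi> ` U)"
    and smooth_\<phi>: "smooth_on U \<phi>" and smooth_\<psi>: "smooth_on (\<phi> ` U) \<psi>"
    and \<psi>_\<phi> [simp]: "z \<in> U \<Longrightarrow> \<psi> (\<phi> z) = z"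
    and subspace_L: "subspace L"
    and in_I_iff: "z \<in> U \<Longrightarrow> z \<in> I \<longleftrightarrow> \<phi> z \<in> L"

lemma smooth_on_if_compatible_id:
  fixes c :: "('a::euclidean_space, 'a) chart"
  assumes "compatible c (UNIV, id)"
  shows "smooth_on (fst c) (snd c)" "smooth_on (snd c ` fst c) (chart_inv c)"
proof -
  have "chart_inv (UNIV :: 'a set, id :: 'a \<Rightarrow> 'a) = id" by (simp add: chart_inv_def)
  then show "smooth_on (fst c) (snd c)" "smooth_on (snd c ` fst c) (chart_inv c)"
    using assms unfolding compatible_def by simp_all
qed

text \<open>Since \<open>I\<close> sits in a Euclidean space, compatibility with the identity chart says that a slice chart
  is a diffeomorphism, and the subspace in which it takes values is the whole space by its dimension.\<close>

lemma embedded_submanifold_flattening: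
  fixes I :: "'a::euclidean_space set"
  assumes "embedded_submanifold DIM('a) euclidean_atlas m I" "x \<in> I"
  obtains U \<phi> \<psi> L where "flattening I U \<phi> \<psi> L" "x \<in> U"
proof -
  obtain c where c: "c \<in> slice_charts DIM('a) euclidean_atlas m I" "x \<in> fst c"
    using assms unfolding embedded_submanifold_def carrier_def by blast
  then obtain E L where E: "subspace E" "dim E = DIM('a)" "is_chart UNIV E c" "compatible c (UNIV, id)"
    and L: "subspace L" "snd c ` (fst c \<inter> I) = snd c ` fst c \<inter> L"
    unfolding slice_charts_def carrier_euclidean by (auto simp: euclidean_atlas_def)
  have "E = UNIV" using E(1,2) by (metis dim_eq_full span_eq_iff)
  have inv: "chart_inv c (snd c z) = z" if "z \<in> fst c" for z
    using E(3) that by (simp add: is_chart_def homeomorphism_def)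
  have "flattening I (fst c) (snd c) (chart_inv c) L"
  proof
    show "open (fst c)" "open (snd c ` fst c)"
      using E(3) \<open>E = UNIV\<close> by (auto simp: is_chart_def)
    show "smooth_on (fst c) (snd c)" "smooth_on (snd c ` fst c) (chart_inv c)"
      using smooth_on_if_compatible_id[OF E(4)] .
    fix z assume z: "z \<in> fst c"
    then show "chart_inv c (snd c z) = z" by (rule inv)
    show "z \<in> I \<longleftrightarrow> snd c z \<in> L"
    proof
      assume "snd c z \<in> L"
      with z have "snd c z \<in> snd c ` (fst c \<inter> I)" unfolding L(2) by blast
      then obtain z' where "z' \<in> fst c \<inter> I" "snd c z' = snd c z" by auto
      with inv[OF z] inv[of z'] show "z \<in> I" by auto
    qed (use z L(2) in blast)
  qed (rule L(1))
  then show ?thesis using that c(2) by blast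
qed

context flattening
begin

abbreviation D\<phi> :: "'a \<Rightarrow> 'a \<Rightarrow> 'a" where "D\<phi> z \<equiv> frechet_derivative \<phi> (at z)"
abbreviation D\<psi> :: "'a \<Rightarrow> 'a \<Rightarrow> 'a" where "D\<psi> z \<equiv> frechet_derivative \<psi> (at z)"

lemma has_derivative_\<phi>: "z \<in> U \<Longrightarrow> (\<phi> has_derivative D\<phi> z) (at z)"
  by (rule smooth_on_has_derivative[OF open_U smooth_\<phi>])

lemma has_derivative_\<psi>: "u \<in> \<phi> ` U \<Longrightarrow> (\<psi> has_derivative D\<psi> u) (at u)"
  by (rule smooth_on_has_derivative[OF open_V smooth_\<psi>])

lemma linear_D\<phi>: "z \<in> U \<Longrightarrow> linear (D\<phi> z)"
  using has_derivative_\<phi> has_derivative_linear by blast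

lemma linear_D\<psi>: "u \<in> \<phi> ` U \<Longrightarrow> linear (D\<psi> u)"
  using has_derivative_\<psi> has_derivative_linear by blast

lemma D\<psi>_D\<phi> [simp]:
  assumes "z \<in> U" shows "D\<psi> (\<phi> z) (D\<phi> z v) = v"
proof -
  have "((\<lambda>z. \<psi> (\<phi> z)) has_derivative (\<lambda>v. D\<psi> (\<phi> z) (D\<phi> z v))) (at z)"
    by (rule has_derivative_compose) (use assms has_derivative_\<phi> has_derivative_\<psi> in auto)
  moreover have "((\<lambda>z. \<psi> (\<phi> z)) has_derivative (\<lambda>v. v)) (at z)"
    by (rule has_derivative_transform_within_open[OF has_derivative_ident open_U assms]) simp
  ultimately show ?thesis by (metis has_derivative_unique)
qed

lemma D\<phi>_D\<psi> [simp]: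
  assumes "z \<in> U" shows "D\<phi> z (D\<psi> (\<phi> z) v) = v"
proof -
  have "((\<lambda>u. \<phi> (\<psi> u)) has_derivative (\<lambda>v. D\<phi> z (D\<psi> (\<phi> z) v))) (at (\<phi> z))"
    by (rule has_derivative_compose) (use assms has_derivative_\<phi> has_derivative_\<psi> in auto)
  moreover have "((\<lambda>u. \<phi> (\<psi> u)) has_derivative (\<lambda>v. v)) (at (\<phi> z))"
    by (rule has_derivative_transform_within_open[OF has_derivative_ident open_V]) (use assms in auto)
  ultimately show ?thesis by (metis has_derivative_unique)
qed

lemma eventually_segment:
  assumes "u \<in> \<phi> ` U"
  obtains e where "e > 0" "\<And>t. t \<in> {-e<..<e} \<Longrightarrow> u + t *\<^sub>R s \<in> \<phi> ` U"
proof -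
  have "open ((\<lambda>t. u + t *\<^sub>R s) -` (\<phi> ` U))"
    by (intro continuous_open_vimage open_V) (auto intro!: continuous_intros)
  moreover have "0 \<in> (\<lambda>t. u + t *\<^sub>R s) -` (\<phi> ` U)" using assms by simp
  ultimately obtain e where "e > 0" "{0-e<..<0+e} \<subseteq> (\<lambda>t. u + t *\<^sub>R s) -` (\<phi> ` U)"
    by (metis ball_eq_greaterThanLessThan openE)
  then show ?thesis by (intro that[of e]) (auto simp: subset_iff)
qed

text \<open>A curve in \<open>I\<close> becomes a curve in \<open>L\<close>, whose velocity lies in the closed set \<open>L\<close> as a limit of
  difference quotients. Conversely the images under \<open>\<psi>\<close> of line segments in \<open>L\<close> are curves in \<open>I\<close>.\<close>

lemma tangent_eq_image:
  assumes "z \<in> U" "z \<in> I"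
  shows "tangent I z = D\<psi> (\<phi> z) ` L"
proof (intro equalityI subsetI)
  fix v assume "v \<in> tangent I z"
  then obtain \<gamma> where \<gamma>: "\<gamma> \<in> curves euclidean_atlas I z" and v: "v = vector_derivative \<gamma> (at 0)"
    by (auto simp: tangent_eq)
  have d: "(\<gamma> has_vector_derivative v) (at 0)" using curves_euclidean_derivative[OF \<gamma>] v by simp
  obtain \<epsilon> where \<epsilon>: "\<epsilon> > 0" "\<gamma> ` {-\<epsilon><..<\<epsilon>} \<subseteq> I" and [simp]: "\<gamma> 0 = z"
    using \<gamma> by (auto simp: curves_euclidean_iff)
  have "isCont \<gamma> 0" using d by (rule has_vector_derivative_continuous)
  then have "\<forall>\<^sub>F t in at 0. \<gamma> t \<in> U"
    using open_U assms(1) by (auto simp: isCont_def topological_tendstoD)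
  moreover have "\<forall>\<^sub>F t in at 0. t \<in> {-\<epsilon><..<\<epsilon>}"
    using \<epsilon>(1) by (intro eventually_at_in_open') auto
  ultimately have ev: "\<forall>\<^sub>F t in at 0. (\<phi> (\<gamma> t) - \<phi> z) /\<^sub>R t \<in> L"
  proof eventually_elim
    case (elim t)
    then have "\<phi> (\<gamma> t) \<in> L" using \<epsilon> in_I_iff by blast
    moreover have "\<phi> z \<in> L" using in_I_iff assms by blast
    ultimately show ?case using subspace_L by (simp add: subspace_diff subspace_scale)
  qed
  have "((\<lambda>t. \<phi> (\<gamma> t)) has_vector_derivative D\<phi> z v) (at 0)"
    using vector_derivative_diff_chain_within[of \<gamma> v 0 UNIV \<phi> "D\<phi> z"] d has_derivative_\<phi>[OF assms(1)]
    by (simp add: o_def has_derivative_at_withinI)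
  then have lim: "((\<lambda>t. (\<phi> (\<gamma> t) - \<phi> z) /\<^sub>R t) \<longlongrightarrow> D\<phi> z v) (at 0)"
    using has_vector_derivative_imp_quotient_tendsto[of "\<lambda>t. \<phi> (\<gamma> t)" "D\<phi> z v"] by simp
  have "D\<phi> z v \<in> L"
    by (rule Lim_in_closed_set[OF closed_subspace[OF subspace_L] ev _ lim]) simp
  then show "v \<in> D\<psi> (\<phi> z) ` L" using assms by (metis D\<psi>_D\<phi> image_eqI)
next
  fix v assume "v \<in> D\<psi> (\<phi> z) ` L"
  then obtain l where l: "l \<in> L" "v = D\<psi> (\<phi> z) l" by blast
  obtain e where e: "e > 0" "\<And>t. t \<in> {-e<..<e} \<Longrightarrow> \<phi> z + t *\<^sub>R l \<in> \<phi> ` U"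
    using eventually_segment assms by blast
  let ?\<gamma> = "\<lambda>t. \<psi> (\<phi> z + t *\<^sub>R l)"
  have "smooth_on {-e<..<e} ?\<gamma>"
    by (intro smooth_on_compose[OF _ open_V _ _ smooth_\<psi>] smooth_on_add smooth_on_const
          smooth_on_linear_compose[OF bounded_linear_scaleR_left] smooth_on_ident)
       (use e in auto)
  moreover have "?\<gamma> t \<in> I" if t: "t \<in> {-e<..<e}" for t
  proof -
    obtain z' where z': "z' \<in> U" "\<phi> z + t *\<^sub>R l = \<phi> z'" using e(2)[OF t] by blast
    moreover have "\<phi> z + t *\<^sub>R l \<in> L"
      using assms in_I_iff l(1) subspace_L by (simp add: subspace_add subspace_scale)
    ultimately show ?thesis using in_I_iff by simp
  qed
  ultimately have \<gamma>: "?\<gamma> \<in> curves euclidean_atlas I z"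
    using e(1) assms by (auto simp: curves_euclidean_iff)
  have "((\<lambda>t. \<phi> z + t *\<^sub>R l) has_vector_derivative l) (at 0)"
    by (auto intro!: derivative_eq_intros)
  then have "(?\<gamma> has_vector_derivative v) (at 0)"
    using vector_derivative_diff_chain_within[of "\<lambda>t. \<phi> z + t *\<^sub>R l" l 0 UNIV \<psi> "D\<psi> (\<phi> z)"]
      has_derivative_\<psi>[of "\<phi> z"] assms l(2)
    by (simp add: o_def has_derivative_at_withinI)
  then show "v \<in> tangent I z"
    using \<gamma> by (auto simp: tangent_eq vector_derivative_at intro!: image_eqI[of _ _ ?\<gamma>])
qed

lemma subspace_tangent: "z \<in> U \<Longrightarrow> z \<in> I \<Longrightarrow> subspace (tangent I z)"
  unfolding tangent_eq_image using linear_D\<psi> subspace_L by (blast intro: linear_subspace_image)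

text \<open>The field with constant coordinates in the flattened picture. Existence matters because the
  second fundamental form is evaluated on a field obtained by \<open>SOME\<close>.\<close>

lemma extending_field_exists:
  assumes "x \<in> U" "x \<in> I" "w \<in> tangent I x"
  shows "\<exists>X. X \<in> extending_fields I x w"
proof -
  obtain l where l: "l \<in> L" "w = D\<psi> (\<phi> x) l" using assms tangent_eq_image by blast
  have "smooth_on U (\<lambda>z. D\<psi> (\<phi> z) l)"
    by (rule smooth_on_derivative_apply[OF open_U open_V smooth_\<psi> smooth_\<phi> _ smooth_on_const[OF open_U]]) simp
  then have "(\<lambda>z. D\<psi> (\<phi> z) l) \<in> extending_fields I x w"
    unfolding extending_fields_def using open_U assms l tangent_eq_image
    by (auto intro!: exI[of _ U])
  then show ?thesis by blast
qed

text \<open>Together with the next two lemmas: the adjoint of the derivative of \<open>\<phi>\<close> maps the orthogonal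
  complement of \<open>L\<close> onto the normal space of \<open>I\<close>. The normal spaces are thus parametrised smoothly
  without orthonormalising any frame.\<close>

lemma adjoint_D\<phi>_normal:
  assumes "z \<in> U" "z \<in> I" "\<And>w. w \<in> L \<Longrightarrow> l \<bullet> w = 0"
  shows "adjoint (D\<phi> z) l \<in> normal I z"
  using assms
  by (auto simp: normal_iff tangent_eq_image adjoint_clauses[OF linear_D\<phi>])

lemma adjoint_D\<psi>_orthogonal:
  assumes "z \<in> U" "z \<in> I" "\<nu> \<in> normal I z" "w \<in> L"
  shows "adjoint (D\<psi> (\<phi> z)) \<nu> \<bullet> w = 0"
  using assms by (auto simp: normal_iff tangent_eq_image adjoint_clauses[OF linear_D\<psi>])

lemma adjoint_D\<phi>_D\<psi>:
  assumes "z \<in> U"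
  shows "adjoint (D\<phi> z) (adjoint (D\<psi> (\<phi> z)) \<nu>) = \<nu>"
proof (rule euclidean_eqI)
  fix b :: 'a
  show "adjoint (D\<phi> z) (adjoint (D\<psi> (\<phi> z)) \<nu>) \<bullet> b = \<nu> \<bullet> b"
    using assms by (simp add: adjoint_clauses[OF linear_D\<phi>] adjoint_clauses[OF linear_D\<psi>])
qed

end

section \<open>The tangent space of \<open>S_CPP\<close> and the map \<open>H\<close>\<close>

abbreviation velocity_at :: "(real \<Rightarrow> 'a::real_normed_vector) \<Rightarrow> 'a" where
  "velocity_at \<gamma> \<equiv> vector_derivative \<gamma> (at 0)"

text \<open>The tangent space of \<open>S_CPP I\<close> at \<open>(a, x)\<close> as a set of pairs of ambient vectors.\<close>

definition T_CPP :: "'a::euclidean_space set \<Rightarrow> 'a \<Rightarrow> 'a \<Rightarrow> ('a \<times> 'a) set" where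
  "T_CPP I a x = (\<lambda>\<gamma>. (velocity_at (fst \<circ> \<gamma>), velocity_at (snd \<circ> \<gamma>))) `
     curves (prod_atlas euclidean_atlas euclidean_atlas) (S_CPP I) (a, x)"

lemma S_CPP_iff: "(a, x) \<in> S_CPP I \<longleftrightarrow> x \<in> I \<and> a - x \<in> normal I x"
  by (simp add: S_CPP_def)

lemma curves_S_CPP_iff:
  "\<gamma> \<in> curves (prod_atlas euclidean_atlas euclidean_atlas) (S_CPP I) (a, x) \<longleftrightarrow>
     fst \<circ> \<gamma> \<in> curves euclidean_atlas UNIV a \<and> snd \<circ> \<gamma> \<in> curves euclidean_atlas I x \<and>
     (\<exists>\<epsilon>>0. \<gamma> ` {-\<epsilon><..<\<epsilon>} \<subseteq> S_CPP I)"
proof -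
  have "snd \<circ> \<gamma> \<in> curves euclidean_atlas I x"
    if "snd \<circ> \<gamma> \<in> curves euclidean_atlas UNIV x" "\<epsilon> > 0" "\<gamma> ` {-\<epsilon><..<\<epsilon>} \<subseteq> S_CPP I" for \<epsilon>
    by (rule curves_image_subset[OF that(1,2)]) (use that(3) in \<open>auto simp: S_CPP_def\<close>)
  then show ?thesis
    using curves_mono[of I UNIV euclidean_atlas x]
    by (auto simp: curves_prod_atlas_iff open_atlas_euclidean carrier_euclidean)
qed

text \<open>For passing between tangent vectors as families indexed by charts and as pairs of ambient
  vectors: both are read off from the same set of curves.\<close>

lemma bij_betw_image_transfer:
  assumes "\<And>c. c \<in> C \<Longrightarrow> F (v c) = f (w c)"
    and "\<And>c d. c \<in> C \<Longrightarrow> d \<in> C \<Longrightarrow> v c = v d \<longleftrightarrow> w c = w d"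
  shows "bij_betw F (v ` C) R \<longleftrightarrow> bij_betw f (w ` C) R"
  using assms by (auto simp: bij_betw_def inj_on_def image_image cong: image_cong)

lemma W_CPP_iff_T_CPP:
  "(a, x) \<in> W_CPP I \<longleftrightarrow> (a, x) \<in> S_CPP I \<and> bij_betw fst (T_CPP I a x) UNIV"
proof -
  note prems = open_atlas_euclidean open_atlas_euclidean
  have sub: "S_CPP I \<subseteq> carrier euclidean_atlas \<times> carrier euclidean_atlas"
    by (simp add: carrier_euclidean)
  show ?thesis
    unfolding W_CPP_def T_CPP_def tangent_space_def mem_Collect_eq
    by (intro conj_cong refl bij_betw_image_transfer)
       (simp_all add: differential_fst[OF prems sub] velocity_prod_atlas_eq_iff[OF prems sub]
          to_vec_velocity velocity_euclidean_eq_iff)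
qed

lemma derivative_chain_vector:
  assumes "(c has_vector_derivative v) (at t)" "(f has_derivative f') (at (c t))"
  shows "((\<lambda>t. f (c t)) has_vector_derivative f' v) (at t)"
  using vector_derivative_diff_chain_within[of c v t UNIV f f'] assms
  by (simp add: o_def has_derivative_at_withinI)

lemma has_vector_derivative_eventually_unique:
  assumes "(f has_vector_derivative u) (at 0)" "(g has_vector_derivative v) (at 0)"
    "e > 0" "\<And>t. t \<in> {-e<..<e} \<Longrightarrow> f t = g t"
  shows "u = v"
proof -
  have "(g has_vector_derivative u) (at 0)"
    by (rule has_vector_derivative_transform_within_open[OF assms(1), of "{-e<..<e}"])
       (use assms in auto)
  then show ?thesis using assms(2) vector_derivative_unique_at by blast
qed

context flattening
begin

lemma curve_in_chart:
  assumes "\<beta> \<in> curves euclidean_atlas I x" "x \<in> U"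
  obtains \<epsilon> where "\<epsilon> > 0" "\<beta> 0 = x" "\<beta> ` {-\<epsilon><..<\<epsilon>} \<subseteq> I \<inter> U" "smooth_on {-\<epsilon><..<\<epsilon>} \<beta>"
proof -
  have "\<beta> \<in> curves euclidean_atlas (I \<inter> U) x"
    by (rule curves_restrict[OF assms(1)])
       (use assms(2) curves_start_in[OF assms(1)] open_U in \<open>auto intro: openin_open_Int\<close>)
  then obtain \<epsilon> where "\<epsilon> > 0" "\<beta> 0 = x" "\<beta> ` {-\<epsilon><..<\<epsilon>} \<subseteq> I \<inter> U" "smooth_on {-\<epsilon><..<\<epsilon>} \<beta>"
    by (auto simp: curves_euclidean_iff)
  then show ?thesis using that[of \<epsilon>] by blast
qed

text \<open>Differentiating \<open>X(x(t)) \<bullet> (a(t) - x(t)) = 0\<close> for a tangent field \<open>X\<close> with \<open>X(x) = w\<close> gives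
  \<open>II(x', w) \<bullet> \<eta> = - w \<bullet> (a' - x')\<close> for all tangent \<open>w\<close>. So the Weingarten map sends \<open>x'\<close> to the
  negative of the tangential part of \<open>a' - x'\<close>, and subtracting this from \<open>x'\<close>, which is tangent
  itself, leaves the tangential part of \<open>a'\<close>.\<close>

lemma Hmap_velocity:
  assumes x: "x \<in> U" and \<alpha>: "\<alpha> \<in> curves euclidean_atlas UNIV a"
    and \<beta>: "\<beta> \<in> curves euclidean_atlas I x"
    and \<epsilon>: "\<epsilon> > 0" "\<And>t. t \<in> {-\<epsilon><..<\<epsilon>} \<Longrightarrow> (\<alpha> t, \<beta> t) \<in> S_CPP I"
  shows "Hmap I x (a - x) (velocity_at \<beta>) = orth_proj (tangent I x) (velocity_at \<alpha>)"
proof -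
  let ?T = "tangent I x" and ?v = "velocity_at \<beta>" and ?a = "velocity_at \<alpha>"
  have [simp]: "\<alpha> 0 = a" "\<beta> 0 = x" using \<alpha> \<beta> by (auto dest: curves_start)
  have xI: "x \<in> I" and \<eta>: "a - x \<in> normal I x" using \<epsilon>(2)[of 0] \<epsilon>(1) by (auto simp: S_CPP_iff)
  have T: "subspace ?T" using subspace_tangent[OF x xI] .
  have v: "?v \<in> ?T" using \<beta> by (simp add: tangent_eq)
  have dv: "((\<lambda>t. \<alpha> t - \<beta> t) has_vector_derivative ?a - ?v) (at 0)"
    by (intro has_vector_derivative_diff curves_euclidean_derivative[OF \<alpha>] curves_euclidean_derivative[OF \<beta>])
  have II: "second_fundamental_form I x ?v w \<bullet> (a - x) = - (w \<bullet> (?a - ?v))" if w: "w \<in> ?T" for w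
  proof -
    define X where "X = (SOME X. X \<in> extending_fields I x w)"
    have "X \<in> extending_fields I x w"
      unfolding X_def using extending_field_exists[OF x xI w] by (rule someI_ex)
    then obtain V where V: "open V" "x \<in> V" "smooth_on V X" "\<And>z. z \<in> I \<Longrightarrow> z \<in> V \<Longrightarrow> X z \<in> tangent I z"
      and [simp]: "X x = w"
      unfolding extending_fields_def by blast
    let ?D = "frechet_derivative X (at x) ?v"
    have "((\<lambda>t. X (\<beta> t)) has_vector_derivative ?D) (at 0)"
      using smooth_on_has_derivative[OF V(1,3,2)]
      by (intro derivative_chain_vector[OF curves_euclidean_derivative[OF \<beta>]]) simp
    from bounded_bilinear.has_vector_derivative[OF bounded_bilinear_inner this dv]
    have deriv: "((\<lambda>t. X (\<beta> t) \<bullet> (\<alpha> t - \<beta> t)) has_vector_derivative w \<bullet> (?a - ?v) + ?D \<bullet> (a - x)) (at 0)"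
      by simp
    have "\<beta> \<in> curves euclidean_atlas (I \<inter> V) x"
      by (rule curves_restrict[OF \<beta>]) (use V(1,2) xI in \<open>auto intro: openin_open_Int\<close>)
    then obtain \<delta> where \<delta>: "\<delta> > 0" "\<beta> ` {-\<delta><..<\<delta>} \<subseteq> I \<inter> V" by (auto simp: curves_euclidean_iff)
    have zero: "X (\<beta> t) \<bullet> (\<alpha> t - \<beta> t) = 0" if t: "t \<in> {-min \<epsilon> \<delta><..<min \<epsilon> \<delta>}" for t
    proof -
      have "t \<in> {-\<epsilon><..<\<epsilon>}" using t by auto
      then have "\<alpha> t - \<beta> t \<in> normal I (\<beta> t)" using \<epsilon>(2) by (simp add: S_CPP_iff)
      moreover have "X (\<beta> t) \<in> tangent I (\<beta> t)" using V(4) \<delta>(2) t by (auto simp: image_subset_iff)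
      ultimately show ?thesis by (simp add: normal_iff inner_commute)
    qed
    have "w \<bullet> (?a - ?v) + ?D \<bullet> (a - x) = 0"
      by (rule has_vector_derivative_eventually_unique[where e = "min \<epsilon> \<delta>", OF deriv has_vector_derivative_const _ zero])
         (use \<epsilon>(1) \<delta>(1) in simp)
    then show ?thesis
      unfolding second_fundamental_form_def X_def[symmetric] normal_part_inner[OF T \<eta>] by linarith
  qed
  note P = orth_proj_in[OF T] orth_proj_orthogonal[OF T]
  have "weingarten I x (a - x) ?v = - orth_proj ?T (?a - ?v)"
    unfolding weingarten_def
  proof (rule the_equality)
    have "- orth_proj ?T (?a - ?v) \<bullet> w = - (w \<bullet> (?a - ?v))" if "w \<in> ?T" for w
      using P(2)[OF that, of "?a - ?v"] by (simp add: inner_diff_left inner_diff_right inner_commute[of w])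
    then show "- orth_proj ?T (?a - ?v) \<in> ?T \<and>
        (\<forall>w\<in>?T. - orth_proj ?T (?a - ?v) \<bullet> w = second_fundamental_form I x ?v w \<bullet> (a - x))"
      using II P(1) T by (simp add: subspace_neg)
  next
    fix u assume u: "u \<in> ?T \<and> (\<forall>w\<in>?T. u \<bullet> w = second_fundamental_form I x ?v w \<bullet> (a - x))"
    have "orth_proj ?T (?a - ?v) = - u"
    proof (rule orth_proj_unique[OF T])
      fix w assume "w \<in> ?T"
      then have "u \<bullet> w = - ((?a - ?v) \<bullet> w)" using u II by (simp add: inner_commute[of w])
      then show "(?a - ?v - - u) \<bullet> w = 0" by (simp add: inner_diff_left inner_add_left)
    qed (use u T in \<open>simp add: subspace_neg\<close>)
    then show "u = - orth_proj ?T (?a - ?v)" by simp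
  qed
  moreover have "orth_proj ?T (?a - ?v) = orth_proj ?T ?a - ?v"
    by (simp add: linear_diff[OF linear_orth_proj[OF T]] orth_proj_id[OF T v])
  ultimately show ?thesis by (simp add: Hmap_def)
qed

text \<open>The normal vector has coordinates in the orthogonal complement of \<open>L\<close>, with respect to which a lift
  is just a curve in that fixed linear space; the linear term \<open>l\<^sub>1\<close> serves to adjust the initial velocity of the lift.\<close>

lemma normal_lift:
  assumes x: "x \<in> U" and \<beta>: "\<beta> \<in> curves euclidean_atlas I x"
    and l: "\<And>w. w \<in> L \<Longrightarrow> l\<^sub>0 \<bullet> w = 0" "\<And>w. w \<in> L \<Longrightarrow> l\<^sub>1 \<bullet> w = 0"
  defines "\<alpha> \<equiv> \<lambda>t. \<beta> t + adjoint (D\<phi> (\<beta> t)) (l\<^sub>0 + t *\<^sub>R l\<^sub>1)"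
  shows "\<alpha> \<in> curves euclidean_atlas UNIV (x + adjoint (D\<phi> x) l\<^sub>0)"
    and "\<exists>\<epsilon>>0. \<forall>t\<in>{-\<epsilon><..<\<epsilon>}. (\<alpha> t, \<beta> t) \<in> S_CPP I"
proof -
  obtain \<epsilon> where \<epsilon>: "\<epsilon> > 0" "\<beta> 0 = x" "\<beta> ` {-\<epsilon><..<\<epsilon>} \<subseteq> I \<inter> U" "smooth_on {-\<epsilon><..<\<epsilon>} \<beta>"
    by (rule curve_in_chart[OF \<beta> x])
  then have \<beta>_in: "\<beta> t \<in> I \<and> \<beta> t \<in> U" if "t \<in> {-\<epsilon><..<\<epsilon>}" for t using that by blast
  have "smooth_on {-\<epsilon><..<\<epsilon>} \<alpha>"
    unfolding \<alpha>_def using \<epsilon>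
    by (intro smooth_on_add smooth_on_adjoint_apply[OF _ open_U smooth_\<phi>] smooth_on_const
          smooth_on_linear_compose[OF bounded_linear_scaleR_left] smooth_on_ident) auto
  then show "\<alpha> \<in> curves euclidean_atlas UNIV (x + adjoint (D\<phi> x) l\<^sub>0)"
    using \<epsilon>(1,2) by (auto simp: curves_euclidean_iff \<alpha>_def)
  have "(\<alpha> t, \<beta> t) \<in> S_CPP I" if "t \<in> {-\<epsilon><..<\<epsilon>}" for t
    using \<beta>_in[OF that] l
    by (auto simp: S_CPP_iff \<alpha>_def inner_add_left intro!: adjoint_D\<phi>_normal)
  then show "\<exists>\<epsilon>>0. \<forall>t\<in>{-\<epsilon><..<\<epsilon>}. (\<alpha> t, \<beta> t) \<in> S_CPP I" using \<epsilon>(1) by blast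
qed

text \<open>Any lift of the curve through \<open>(a, x)\<close> has an initial velocity with tangential part \<open>H x'\<close> by
  \<open>Hmap_velocity\<close>; this also shows that \<open>H\<close> maps into the tangent space. The remaining
  freedom in \<open>s\<close> is a normal vector, and it is produced by the linear term of the lift.\<close>

lemma lift_curve:
  assumes x: "x \<in> U" and ax: "(a, x) \<in> S_CPP I" and \<beta>: "\<beta> \<in> curves euclidean_atlas I x"
  shows "Hmap I x (a - x) (velocity_at \<beta>) \<in> tangent I x" (is ?in)
    and "orth_proj (tangent I x) s = Hmap I x (a - x) (velocity_at \<beta>) \<Longrightarrow>
      \<exists>\<alpha>\<in>curves euclidean_atlas UNIV a. velocity_at \<alpha> = s \<and>
        (\<exists>\<epsilon>>0. \<forall>t\<in>{-\<epsilon><..<\<epsilon>}. (\<alpha> t, \<beta> t) \<in> S_CPP I)" (is "?eq \<Longrightarrow> ?lift")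
proof -
  let ?T = "tangent I x"
  have xI: "x \<in> I" and \<eta>: "a - x \<in> normal I x" using ax by (auto simp: S_CPP_iff)
  have T: "subspace ?T" using subspace_tangent[OF x xI] .
  \<comment> \<open>The coordinates of \<open>a - x\<close> in the orthogonal complement of \<open>L\<close>.\<close>
  define l\<^sub>0 where "l\<^sub>0 = adjoint (D\<psi> (\<phi> x)) (a - x)"
  have l0: "l\<^sub>0 \<bullet> w = 0" if "w \<in> L" for w
    unfolding l\<^sub>0_def by (rule adjoint_D\<psi>_orthogonal[OF x xI \<eta> that])
  have a: "x + adjoint (D\<phi> x) l\<^sub>0 = a" by (simp add: l\<^sub>0_def adjoint_D\<phi>_D\<psi>[OF x])
  define \<alpha> where "\<alpha> l t = \<beta> t + adjoint (D\<phi> (\<beta> t)) (l\<^sub>0 + t *\<^sub>R l)" for l t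
  have lift: "\<alpha> l \<in> curves euclidean_atlas UNIV a" "\<exists>\<epsilon>>0. \<forall>t\<in>{-\<epsilon><..<\<epsilon>}. (\<alpha> l t, \<beta> t) \<in> S_CPP I"
    if "\<And>w. w \<in> L \<Longrightarrow> l \<bullet> w = 0" for l
    using normal_lift[OF x \<beta>, of l\<^sub>0 l] l0 that unfolding \<alpha>_def[abs_def] a by blast+
  have H: "Hmap I x (a - x) (velocity_at \<beta>) = orth_proj ?T (velocity_at (\<alpha> 0))"
    using lift[of 0] Hmap_velocity[OF x _ \<beta>, of "\<alpha> 0" a] by auto
  then show ?in using orth_proj_in[OF T] by simp
  assume ?eq
  let ?n = "s - velocity_at (\<alpha> 0)"
  have "orth_proj ?T ?n = 0"
    using \<open>?eq\<close> H by (simp add: linear_diff[OF linear_orth_proj[OF T]])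
  then have n: "?n \<in> normal I x"
    using orth_proj_orthogonal[OF T, of _ ?n] by (simp add: normal_iff)
  \<comment> \<open>The lift with constant coordinates \<open>l\<^sub>0\<close> misses \<open>s\<close> by a normal vector; its coordinates
      become the linear term.\<close>
  define l where "l = adjoint (D\<psi> (\<phi> x)) ?n"
  have l: "l \<bullet> w = 0" if "w \<in> L" for w
    unfolding l_def by (rule adjoint_D\<psi>_orthogonal[OF x xI n that])
  obtain \<epsilon> where \<epsilon>: "\<epsilon> > 0" "\<beta> 0 = x" "\<beta> ` {-\<epsilon><..<\<epsilon>} \<subseteq> I \<inter> U" "smooth_on {-\<epsilon><..<\<epsilon>} \<beta>"
    by (rule curve_in_chart[OF \<beta> x])
  then have \<beta>_in: "\<beta> t \<in> I \<and> \<beta> t \<in> U" if "t \<in> {-\<epsilon><..<\<epsilon>}" for t using that by blast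
  let ?B = "\<lambda>t. adjoint (D\<phi> (\<beta> t)) l"
  have "smooth_on {-\<epsilon><..<\<epsilon>} ?B"
    using \<epsilon> by (intro smooth_on_adjoint_apply[OF _ open_U smooth_\<phi>] smooth_on_const) auto
  then have "?B differentiable (at 0)"
    using smooth_on_has_derivative[of "{-\<epsilon><..<\<epsilon>}" ?B 0] \<epsilon>(1) by (auto simp: differentiable_def)
  then obtain B' where "(?B has_vector_derivative B') (at 0)"
    by (auto simp: vector_derivative_works)
  from has_vector_derivative_add[OF curves_euclidean_derivative[OF lift(1)[of 0]]
      bounded_bilinear.has_vector_derivative[OF bounded_bilinear_scaleR has_vector_derivative_id this]]
  have "((\<lambda>t. \<alpha> 0 t + t *\<^sub>R ?B t) has_vector_derivative velocity_at (\<alpha> 0) + ?B 0) (at 0)"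
    by simp
  moreover have "\<alpha> l t = \<alpha> 0 t + t *\<^sub>R ?B t" if "t \<in> {-\<epsilon><..<\<epsilon>}" for t
  proof -
    have "linear (adjoint (D\<phi> (\<beta> t)))"
      using \<beta>_in[OF that] by (intro adjoint_linear linear_D\<phi>) simp
    then show ?thesis by (simp add: \<alpha>_def linear_add linear_scale)
  qed
  moreover have "?B 0 = ?n" by (simp add: \<epsilon>(2) l_def adjoint_D\<phi>_D\<psi>[OF x])
  ultimately have "velocity_at (\<alpha> l) = s"
    using has_vector_derivative_eventually_unique[OF curves_euclidean_derivative[OF lift(1)[OF l]]]
      \<epsilon>(1) by force
  then show ?lift using lift[OF l] by blast
qed

lemma T_CPP_eq_Hmap:
  assumes x: "x \<in> U" and ax: "(a, x) \<in> S_CPP I"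
  shows "T_CPP I a x = {(s, v). v \<in> tangent I x \<and> orth_proj (tangent I x) s = Hmap I x (a - x) v}"
proof (intro equalityI subrelI)
  fix s v assume "(s, v) \<in> T_CPP I a x"
  then obtain \<gamma> where \<gamma>: "\<gamma> \<in> curves (prod_atlas euclidean_atlas euclidean_atlas) (S_CPP I) (a, x)"
    and sv: "s = velocity_at (fst \<circ> \<gamma>)" "v = velocity_at (snd \<circ> \<gamma>)"
    by (auto simp: T_CPP_def)
  from \<gamma> obtain \<epsilon> where 1: "fst \<circ> \<gamma> \<in> curves euclidean_atlas UNIV a"
      "snd \<circ> \<gamma> \<in> curves euclidean_atlas I x" "\<epsilon> > 0" "\<gamma> ` {-\<epsilon><..<\<epsilon>} \<subseteq> S_CPP I"
    by (auto simp: curves_S_CPP_iff)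
  then have "v \<in> tangent I x" using sv by (auto simp: tangent_eq)
  moreover have "Hmap I x (a - x) v = orth_proj (tangent I x) s"
    unfolding sv by (rule Hmap_velocity[OF x 1(1,2,3)]) (use 1(4) in auto)
  ultimately show "(s, v) \<in> {(s, v). v \<in> tangent I x \<and> orth_proj (tangent I x) s = Hmap I x (a - x) v}"
    by simp
next
  fix s v assume "(s, v) \<in> {(s, v). v \<in> tangent I x \<and> orth_proj (tangent I x) s = Hmap I x (a - x) v}"
  then obtain \<beta> where \<beta>: "\<beta> \<in> curves euclidean_atlas I x" "v = velocity_at \<beta>"
    and eq: "orth_proj (tangent I x) s = Hmap I x (a - x) (velocity_at \<beta>)"
    by (auto simp: tangent_eq)
  from lift_curve(2)[OF x ax \<beta>(1) eq]
  obtain \<alpha> \<epsilon> where \<alpha>: "\<alpha> \<in> curves euclidean_atlas UNIV a" "velocity_at \<alpha> = s"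
    "\<epsilon> > 0" "\<forall>t\<in>{-\<epsilon><..<\<epsilon>}. (\<alpha> t, \<beta> t) \<in> S_CPP I" by blast
  have "(\<lambda>t. (\<alpha> t, \<beta> t)) \<in> curves (prod_atlas euclidean_atlas euclidean_atlas) (S_CPP I) (a, x)"
    using \<alpha> \<beta> by (auto simp: curves_S_CPP_iff o_def image_subset_iff)
  then show "(s, v) \<in> T_CPP I a x"
    unfolding T_CPP_def using \<alpha>(2) \<beta>(2) by (force simp: o_def)
qed

lemma Hmap_in_tangent:
  assumes "x \<in> U" "(a, x) \<in> S_CPP I" "v \<in> tangent I x"
  shows "Hmap I x (a - x) v \<in> tangent I x"
  using assms lift_curve(1)[OF assms(1,2)] by (auto simp: tangent_eq)

text \<open>In terms of the tangent space just computed: \<open>a'\<close> determines \<open>x'\<close> uniquely iff the equation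
  \<open>H x' = P a'\<close> is uniquely solvable, and \<open>P a'\<close> runs through the whole tangent space.\<close>

lemma W_CPP_iff_Hmap:
  assumes x: "x \<in> U" and ax: "(a, x) \<in> S_CPP I"
  shows "(a, x) \<in> W_CPP I \<longleftrightarrow> bij_betw (Hmap I x (a - x)) (tangent I x) (tangent I x)"
proof -
  let ?T = "tangent I x" and ?H = "Hmap I x (a - x)"
  let ?K = "{(s, v). v \<in> ?T \<and> orth_proj ?T s = ?H v}"
  have T: "subspace ?T" using subspace_tangent[OF x] ax by (simp add: S_CPP_iff)
  note P = orth_proj_in[OF T] orth_proj_id[OF T] and H = Hmap_in_tangent[OF x ax]
  have "bij_betw fst ?K UNIV \<longleftrightarrow> bij_betw ?H ?T ?T"
  proof
    assume bij: "bij_betw fst ?K UNIV"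
    then have inj: "inj_on fst ?K" and surj: "fst ` ?K = UNIV" by (auto simp: bij_betw_def)
    have "v = v'" if "v \<in> ?T" "v' \<in> ?T" "?H v = ?H v'" for v v'
    proof -
      have "(?H v, v) \<in> ?K" "(?H v, v') \<in> ?K" using that P(2) H by auto
      then show ?thesis using inj_onD[OF inj, of "(?H v, v)" "(?H v, v')"] by simp
    qed
    moreover have "b \<in> ?H ` ?T" if "b \<in> ?T" for b
    proof -
      have "b \<in> fst ` ?K" using surj by blast
      then obtain v where "v \<in> ?T" "orth_proj ?T b = ?H v" by auto
      then show ?thesis using P(2)[OF that] by auto
    qed
    ultimately show "bij_betw ?H ?T ?T" using H by (auto simp: bij_betw_def inj_on_def)
  next
    assume bij: "bij_betw ?H ?T ?T"
    have "inj_on fst ?K" using bij by (auto simp: bij_betw_def inj_on_def)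
    moreover have "s \<in> fst ` ?K" for s
    proof -
      obtain v where "v \<in> ?T" "orth_proj ?T s = ?H v"
        using bij P(1)[of s] by (metis bij_betw_imp_surj_on imageE)
      then show ?thesis by force
    qed
    ultimately show "bij_betw fst ?K UNIV" by (auto simp: bij_betw_def)
  qed
  then show ?thesis using ax by (simp add: W_CPP_iff_T_CPP T_CPP_eq_Hmap[OF x ax])
qed

end

section \<open>Openness of the well-posed part of \<open>S_CPP\<close>\<close>

text \<open>An injective linear map on a finite-dimensional space is bounded below, which survives a small
  perturbation; the sum of the deviations on basis vectors bounds the operator norm of the
  perturbation.\<close>

lemma injective_derivative_open:
  fixes F :: "'a::euclidean_space \<Rightarrow> 'b::euclidean_space"
  assumes "open \<Omega>" "smooth_on \<Omega> F" "w\<^sub>0 \<in> \<Omega>" "inj (frechet_derivative F (at w\<^sub>0))"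
  obtains \<Omega>' where "open \<Omega>'" "w\<^sub>0 \<in> \<Omega>'" "\<Omega>' \<subseteq> \<Omega>"
    "\<And>w. w \<in> \<Omega>' \<Longrightarrow> inj (frechet_derivative F (at w))"
proof -
  let ?D = "\<lambda>w. frechet_derivative F (at w)"
  have lin: "linear (?D w)" if "w \<in> \<Omega>" for w
    using smooth_on_has_derivative[OF assms(1,2) that] has_derivative_linear by blast
  obtain B where B: "B > 0" "\<And>s. B * norm s \<le> norm (?D w\<^sub>0 s)"
    using linear_inj_bounded_below_pos[OF lin[OF assms(3)] assms(4)] by blast
  define N where "N w = (\<Sum>b\<in>Basis. norm (?D w b - ?D w\<^sub>0 b))" for w
  have "continuous_on \<Omega> N"
    unfolding N_def
    by (intro continuous_intros smooth_on_imp_continuous_on smooth_on_frechet_derivative assms)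
  then have "open (\<Omega> \<inter> N -` {..<B})"
    by (rule continuous_open_preimage[OF _ assms(1)]) simp
  moreover have "w\<^sub>0 \<in> \<Omega> \<inter> N -` {..<B}" using assms(3) B(1) by (simp add: N_def)
  moreover have "inj (?D w)" if w: "w \<in> \<Omega> \<inter> N -` {..<B}" for w
  proof -
    have wO: "w \<in> \<Omega>" and NB: "N w < B" using w by auto
    have "s = 0" if "?D w s = 0" for s
    proof (rule ccontr)
      assume "s \<noteq> 0"
      have l: "linear (\<lambda>s. ?D w s - ?D w\<^sub>0 s)"
        using lin[OF wO] lin[OF assms(3)] by (rule linear_compose_sub)
      have "B * norm s \<le> norm (?D w s - ?D w\<^sub>0 s)" using B(2)[of s] that by simp
      also have "\<dots> = norm (\<Sum>b\<in>Basis. (s \<bullet> b) *\<^sub>R (?D w b - ?D w\<^sub>0 b))"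
        using linear_sum[OF l, of "\<lambda>b. (s \<bullet> b) *\<^sub>R b" Basis] linear_scale[OF l]
        by (simp add: euclidean_representation)
      also have "\<dots> \<le> (\<Sum>b\<in>Basis. norm s * norm (?D w b - ?D w\<^sub>0 b))"
        by (intro sum_norm_le) (auto intro!: mult_right_mono Basis_le_norm)
      also have "\<dots> = norm s * N w" by (simp add: N_def sum_distrib_left)
      also have "\<dots> < norm s * B" using \<open>s \<noteq> 0\<close> NB by simp
      finally show False by (simp add: mult.commute)
    qed
    then show ?thesis using linear_injective_0[OF lin[OF wO]] by blast
  qed
  ultimately show ?thesis using that[of "\<Omega> \<inter> N -` {..<B}"] by blast
qed

context flattening
begin

text \<open>A parametrisation of \<open>S_CPP I\<close> over \<open>U\<close> by an open subset of the ambient space, split as the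
  direct sum of \<open>L\<close> and its orthogonal complement. The \<open>L\<close>-component gives the point \<open>foot w\<close> of
  \<open>I\<close>, the other one a normal vector there; \<open>tip w\<close> is the foot moved by that normal vector. So
  \<open>(tip w, foot w)\<close> is the point of \<open>S_CPP I\<close> with parameter \<open>w\<close>, and \<open>coord\<close> recovers the
  parameter.\<close>

definition param_dom :: "'a set" where "param_dom = orth_proj L -` (\<phi> ` U)"
definition foot :: "'a \<Rightarrow> 'a" where "foot w = \<psi> (orth_proj L w)"
definition tip :: "'a \<Rightarrow> 'a" where
  "tip w = foot w + adjoint (D\<phi> (foot w)) (w - orth_proj L w)"
definition coord :: "'a \<times> 'a \<Rightarrow> 'a" where
  "coord p = \<phi> (snd p) + adjoint (D\<psi> (\<phi> (snd p))) (fst p - snd p)"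

lemma bounded_linear_orth_proj_L: "bounded_linear (orth_proj L)"
  using linear_orth_proj[OF subspace_L] by (simp add: linear_conv_bounded_linear)

lemma open_param_dom: "open param_dom"
  unfolding param_dom_def
  by (intro continuous_open_vimage open_V linear_continuous_at bounded_linear_orth_proj_L)

lemma smooth_orth_proj: "open S \<Longrightarrow> smooth_on S (orth_proj L)"
  using smooth_on_linear_compose[OF bounded_linear_orth_proj_L _ smooth_on_ident] by blast

lemma smooth_foot: "smooth_on param_dom foot"
  unfolding foot_def[abs_def]
  by (rule smooth_on_compose[OF open_param_dom open_V _ smooth_orth_proj smooth_\<psi>])
     (auto simp: param_dom_def open_param_dom[unfolded param_dom_def])

lemma foot_in:
  assumes "w \<in> param_dom" shows "foot w \<in> U" "foot w \<in> I" "\<phi> (foot w) = orth_proj L w"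
proof -
  obtain z where z: "z \<in> U" "orth_proj L w = \<phi> z" using assms by (auto simp: param_dom_def)
  then show "foot w \<in> U" "\<phi> (foot w) = orth_proj L w" by (simp_all add: foot_def)
  show "foot w \<in> I"
    using z in_I_iff[OF z(1)] orth_proj_in[OF subspace_L, of w] by (simp add: foot_def)
qed

lemma smooth_tip: "smooth_on param_dom tip"
  unfolding tip_def[abs_def] using foot_in(1)
  by (intro smooth_on_add smooth_on_adjoint_apply[OF _ open_U smooth_\<phi>] smooth_on_diff smooth_on_ident
        smooth_orth_proj open_param_dom smooth_foot) auto

lemma smooth_coord: "smooth_on (UNIV \<times> U) coord"
proof -
  have o: "open (UNIV \<times> U :: ('a \<times> 'a) set)" by (intro open_Times open_UNIV open_U)
  have p: "smooth_on (UNIV \<times> U :: ('a \<times> 'a) set) fst" "smooth_on (UNIV \<times> U :: ('a \<times> 'a) set) snd"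
    using smooth_on_linear_compose[OF bounded_linear_fst o smooth_on_ident[OF o]]
      smooth_on_linear_compose[OF bounded_linear_snd o smooth_on_ident[OF o]] by simp_all
  have \<phi>: "smooth_on (UNIV \<times> U :: ('a \<times> 'a) set) (\<lambda>p. \<phi> (snd p))"
    by (rule smooth_on_compose[OF o open_U _ p(2) smooth_\<phi>]) auto
  show ?thesis
    unfolding coord_def[abs_def]
    by (intro smooth_on_add \<phi> o smooth_on_adjoint_apply[OF _ open_V smooth_\<psi>] smooth_on_diff p) auto
qed

lemma param_in_S_CPP: "w \<in> param_dom \<Longrightarrow> (tip w, foot w) \<in> S_CPP I"
  using foot_in[of w] orth_proj_orthogonal[OF subspace_L, of _ w]
  by (auto simp: S_CPP_iff tip_def intro!: adjoint_D\<phi>_normal)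

lemma param_coord:
  assumes "(a, x) \<in> S_CPP I" "x \<in> U"
  shows "coord (a, x) \<in> param_dom" "tip (coord (a, x)) = a" "foot (coord (a, x)) = x"
proof -
  have x: "x \<in> I" "a - x \<in> normal I x" using assms by (auto simp: S_CPP_iff)
  have P: "orth_proj L (coord (a, x)) = \<phi> x"
    using adjoint_D\<psi>_orthogonal[OF assms(2) x] in_I_iff[OF assms(2)] x(1)
    by (intro orth_proj_unique[OF subspace_L]) (auto simp: coord_def)
  show "coord (a, x) \<in> param_dom" using P assms(2) by (auto simp: param_dom_def)
  show f: "foot (coord (a, x)) = x" using P assms(2) by (simp add: foot_def)
  show "tip (coord (a, x)) = a"
    by (simp add: tip_def f P) (simp add: coord_def adjoint_D\<phi>_D\<psi>[OF assms(2)])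
qed

text \<open>Curves in \<open>S_CPP I\<close> are the images of curves in the parameter space: one direction pulls back along
  the smooth map \<open>coord\<close>, the other maps line segments forward.\<close>

lemma T_CPP_param:
  assumes "(a, x) \<in> S_CPP I" "x \<in> U"
  defines "w \<equiv> coord (a, x)"
  shows "T_CPP I a x = range (\<lambda>s. (frechet_derivative tip (at w) s, frechet_derivative foot (at w) s))"
proof (intro equalityI subsetI)
  note w = param_coord[OF assms(1,2), folded w_def]
  have D: "(tip has_derivative frechet_derivative tip (at w)) (at w)"
    "(foot has_derivative frechet_derivative foot (at w)) (at w)"
    using smooth_on_has_derivative[OF open_param_dom] smooth_tip smooth_foot w(1) by auto
  {
    fix p assume "p \<in> T_CPP I a x"
    then obtain \<gamma> where \<gamma>: "\<gamma> \<in> curves (prod_atlas euclidean_atlas euclidean_atlas) (S_CPP I) (a, x)"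
      and p: "p = (velocity_at (fst \<circ> \<gamma>), velocity_at (snd \<circ> \<gamma>))"
      by (auto simp: T_CPP_def)
    from \<gamma> obtain \<epsilon>\<^sub>1 where 1: "fst \<circ> \<gamma> \<in> curves euclidean_atlas UNIV a"
        "snd \<circ> \<gamma> \<in> curves euclidean_atlas I x" "\<epsilon>\<^sub>1 > 0" "\<gamma> ` {-\<epsilon>\<^sub>1<..<\<epsilon>\<^sub>1} \<subseteq> S_CPP I"
      by (auto simp: curves_S_CPP_iff)
    obtain \<epsilon>\<^sub>2 where 2: "\<epsilon>\<^sub>2 > 0" "(snd \<circ> \<gamma>) ` {-\<epsilon>\<^sub>2<..<\<epsilon>\<^sub>2} \<subseteq> I \<inter> U"
      by (rule curve_in_chart[OF 1(2) assms(2)])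
    have [simp]: "\<gamma> 0 = (a, x)" using curves_start[OF \<gamma>] .
    have "(\<gamma> has_vector_derivative p) (at 0)"
      using has_derivative_Pair[OF curves_euclidean_derivative[OF 1(1), unfolded has_vector_derivative_def]
          curves_euclidean_derivative[OF 1(2), unfolded has_vector_derivative_def]]
      by (simp add: p has_vector_derivative_def)
    moreover have "(coord has_derivative frechet_derivative coord (at (a, x))) (at (\<gamma> 0))"
      using smooth_on_has_derivative[OF _ smooth_coord, of "(a, x)"] assms(2) open_U
      by (simp add: open_Times)
    ultimately have c: "((\<lambda>t. coord (\<gamma> t)) has_vector_derivative
        frechet_derivative coord (at (a, x)) p) (at 0)" (is "(_ has_vector_derivative ?s) _")
      by (rule derivative_chain_vector)
    have e: "tip (coord (\<gamma> t)) = (fst \<circ> \<gamma>) t" "foot (coord (\<gamma> t)) = (snd \<circ> \<gamma>) t"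
      if "t \<in> {-min \<epsilon>\<^sub>1 \<epsilon>\<^sub>2<..<min \<epsilon>\<^sub>1 \<epsilon>\<^sub>2}" for t
    proof -
      have t: "t \<in> {-\<epsilon>\<^sub>1<..<\<epsilon>\<^sub>1}" "t \<in> {-\<epsilon>\<^sub>2<..<\<epsilon>\<^sub>2}" using that by auto
      obtain a' x' where \<gamma>t: "\<gamma> t = (a', x')" by fastforce
      with 1(4) 2(2) t have "(a', x') \<in> S_CPP I" "x' \<in> U" by force+
      from param_coord[OF this] show "tip (coord (\<gamma> t)) = (fst \<circ> \<gamma>) t" "foot (coord (\<gamma> t)) = (snd \<circ> \<gamma>) t"
        by (simp_all add: \<gamma>t)
    qed
    have d: "((\<lambda>t. tip (coord (\<gamma> t))) has_vector_derivative frechet_derivative tip (at w) ?s) (at 0)"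
      "((\<lambda>t. foot (coord (\<gamma> t))) has_vector_derivative frechet_derivative foot (at w) ?s) (at 0)"
      by (rule derivative_chain_vector[OF c]; use D in \<open>simp add: w_def\<close>)+
    have pos: "min \<epsilon>\<^sub>1 \<epsilon>\<^sub>2 > 0" using 1(3) 2(1) by simp
    have "frechet_derivative tip (at w) ?s = velocity_at (fst \<circ> \<gamma>)"
      by (rule has_vector_derivative_eventually_unique[OF d(1) curves_euclidean_derivative[OF 1(1)] pos e(1)])
    moreover have "frechet_derivative foot (at w) ?s = velocity_at (snd \<circ> \<gamma>)"
      by (rule has_vector_derivative_eventually_unique[OF d(2) curves_euclidean_derivative[OF 1(2)] pos e(2)])
    ultimately show "p \<in> range (\<lambda>s. (frechet_derivative tip (at w) s, frechet_derivative foot (at w) s))"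
      by (intro image_eqI[of _ _ ?s]) (simp_all add: p)
  }
  {
    fix p assume "p \<in> range (\<lambda>s. (frechet_derivative tip (at w) s, frechet_derivative foot (at w) s))"
    then obtain s where p: "p = (frechet_derivative tip (at w) s, frechet_derivative foot (at w) s)" by blast
    let ?c = "\<lambda>t. w + t *\<^sub>R s"
    have "open (?c -` param_dom)"
      by (intro continuous_open_vimage open_param_dom) (auto intro!: continuous_intros)
    moreover have "0 \<in> ?c -` param_dom" using w(1) by simp
    ultimately obtain e where e: "e > 0" "{0-e<..<0+e} \<subseteq> ?c -` param_dom"
      by (metis ball_eq_greaterThanLessThan openE)
    then have dom: "?c t \<in> param_dom" if "t \<in> {-e<..<e}" for t using that by auto
    have c: "smooth_on {-e<..<e} ?c"
      by (intro smooth_on_add smooth_on_const smooth_on_linear_compose[OF bounded_linear_scaleR_left]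
            smooth_on_ident) auto
    have sm: "smooth_on {-e<..<e} (\<lambda>t. tip (?c t))" "smooth_on {-e<..<e} (\<lambda>t. foot (?c t))"
      using dom by (auto intro!: smooth_on_compose[OF _ open_param_dom _ c] smooth_tip smooth_foot)
    have d: "(?c has_vector_derivative s) (at 0)" by (auto intro!: derivative_eq_intros)
    have v: "velocity_at (\<lambda>t. tip (?c t)) = frechet_derivative tip (at w) s"
      "velocity_at (\<lambda>t. foot (?c t)) = frechet_derivative foot (at w) s"
      using derivative_chain_vector[OF d, of tip "frechet_derivative tip (at w)"]
        derivative_chain_vector[OF d, of foot "frechet_derivative foot (at w)"] D
      by (simp_all add: vector_derivative_at)
    have "(\<lambda>t. (tip (?c t), foot (?c t))) \<in>
        curves (prod_atlas euclidean_atlas euclidean_atlas) (S_CPP I) (a, x)"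
      unfolding curves_S_CPP_iff using e(1) sm w param_in_S_CPP[OF dom] foot_in(2)[OF dom]
      by (auto simp: curves_euclidean_iff o_def image_subset_iff)
    then show "p \<in> T_CPP I a x"
      unfolding T_CPP_def p using v by (force simp: o_def)
  }
qed

text \<open>By \<open>T_CPP_param\<close>, the first projection restricted to the tangent space is onto iff the derivative
  of \<open>tip\<close> is onto, hence, domain and codomain being the same space, iff that derivative is
  invertible. Invertibility is an open condition on the parameter.\<close>

lemma W_CPP_open:
  assumes "(a\<^sub>0, x\<^sub>0) \<in> W_CPP I" "x\<^sub>0 \<in> U"
  shows "\<exists>N. open N \<and> (a\<^sub>0, x\<^sub>0) \<in> N \<and> S_CPP I \<inter> N \<subseteq> W_CPP I"
proof -
  let ?D = "\<lambda>w. frechet_derivative tip (at w)"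
  have lin: "linear (?D w)" if "w \<in> param_dom" for w
    using smooth_on_has_derivative[OF open_param_dom smooth_tip that] has_derivative_linear by blast
  have 0: "(a\<^sub>0, x\<^sub>0) \<in> S_CPP I" "bij_betw fst (T_CPP I a\<^sub>0 x\<^sub>0) UNIV"
    using assms(1) by (auto simp: W_CPP_iff_T_CPP)
  let ?w = "coord (a\<^sub>0, x\<^sub>0)"
  have w: "?w \<in> param_dom" using param_coord(1)[OF 0(1) assms(2)] .
  have "surj (?D ?w)"
  proof -
    have "fst ` T_CPP I a\<^sub>0 x\<^sub>0 = UNIV" using 0(2) by (rule bij_betw_imp_surj_on)
    then show ?thesis by (simp add: T_CPP_param[OF 0(1) assms(2)] image_image)
  qed
  then have "inj (?D ?w)" using linear_surjective_imp_injective[OF lin[OF w]] by blast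
  then obtain \<Omega> where \<Omega>: "open \<Omega>" "?w \<in> \<Omega>" "\<Omega> \<subseteq> param_dom" "\<And>w. w \<in> \<Omega> \<Longrightarrow> inj (?D w)"
    using injective_derivative_open[OF open_param_dom smooth_tip w] by blast
  let ?N = "(UNIV \<times> U) \<inter> coord -` \<Omega>"
  have o: "open (UNIV \<times> U :: ('a \<times> 'a) set)" by (intro open_Times open_UNIV open_U)
  have "open ?N"
    by (rule continuous_open_preimage[OF smooth_on_imp_continuous_on[OF o smooth_coord] o \<Omega>(1)])
  moreover have "(a\<^sub>0, x\<^sub>0) \<in> ?N" using \<Omega>(2) assms(2) by simp
  moreover have "(a, x) \<in> W_CPP I" if ax: "(a, x) \<in> S_CPP I" and N: "(a, x) \<in> ?N" for a x
  proof -
    have x: "x \<in> U" and wO: "coord (a, x) \<in> \<Omega>" using N by auto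
    have inj: "inj (?D (coord (a, x)))" using \<Omega>(4)[OF wO] .
    then have "surj (?D (coord (a, x)))"
      using linear_injective_imp_surjective lin wO \<Omega>(3) by blast
    with inj show ?thesis
      by (auto simp: W_CPP_iff_T_CPP ax T_CPP_param[OF ax x] bij_betw_def inj_on_def image_image)
  qed
  ultimately show ?thesis by (intro exI[of _ ?N]) auto
qed

end

section \<open>The condition number\<close>

lemma embedded_submanifold_subset_carrier:
  assumes "embedded_submanifold k A m S"
  shows "S \<subseteq> carrier A"
proof
  fix p assume "p \<in> S"
  then obtain c where "c \<in> slice_charts k A m S" "p \<in> fst c"
    using assms unfolding embedded_submanifold_def carrier_def by blast
  then have "openin (top_of_set (carrier A)) (fst c)"
    unfolding slice_charts_def is_chart_def by blast
  with \<open>p \<in> fst c\<close> show "p \<in> carrier A" using openin_imp_subset by blast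
qed

text \<open>Projecting does not increase norms, and the vectors of \<open>T\<close> themselves compete in the supremum over
  the whole space. The value at 0 matters because nonzero vectors orthogonal to \<open>T\<close> are sent there.\<close>

lemma spectral_norm_orth_proj:
  assumes T: "subspace T" and 0: "N (F 0) = 0"
  shows "spectral_norm UNIV N (\<lambda>t. F (orth_proj T t)) = spectral_norm T N F"
  unfolding spectral_norm_def
proof (intro antisym SUP_least)
  fix t :: 'a assume "t \<in> UNIV - {0}"
  let ?u = "orth_proj T t"
  show "ennreal (N (F ?u) / norm t) \<le> (SUP t\<in>T - {0}. ennreal (N (F t) / norm t))"
  proof (cases "?u = 0 \<or> N (F ?u) \<le> 0")
    case True
    then show ?thesis using 0 by (auto simp: ennreal_neg divide_nonpos_nonneg)
  next
    case False
    have "N (F ?u) / norm t \<le> N (F ?u) / norm ?u"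
      using False norm_orth_proj_le[OF T, of t] by (intro divide_left_mono mult_pos_pos) auto
    then have "ennreal (N (F ?u) / norm t) \<le> ennreal (N (F ?u) / norm ?u)" by (rule ennreal_leI)
    also have "\<dots> \<le> (SUP t\<in>T - {0}. ennreal (N (F t) / norm t))"
      using False orth_proj_in[OF T] by (intro SUP_upper) auto
    finally show ?thesis .
  qed
next
  fix t assume t: "t \<in> T - {0}"
  then have "ennreal (N (F t) / norm t) = ennreal (N (F (orth_proj T t)) / norm t)"
    by (simp add: orth_proj_id[OF T])
  also have "\<dots> \<le> (SUP t\<in>UNIV - {0}. ennreal (N (F (orth_proj T t)) / norm t))"
    using t by (intro SUP_upper) auto
  finally show "ennreal (N (F t) / norm t) \<le> (SUP t\<in>UNIV - {0}. ennreal (N (F (orth_proj T t)) / norm t))" .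
qed

lemma
  fixes S :: "('a::euclidean_space \<times> 'o::topological_space) set"
    and A :: "('o, 'e::euclidean_space) chart set"
  assumes "open_atlas A" "S \<subseteq> UNIV \<times> carrier A"
    and "\<beta> \<in> curves (prod_atlas euclidean_atlas A) S p"
  shows D_pi_I_velocity:
      "D_pi_I A S p (velocity (prod_atlas euclidean_atlas A) \<beta>) = velocity_at (fst \<circ> \<beta>)"
    and D_pi_O_velocity:
      "D_pi_O A S p (velocity (prod_atlas euclidean_atlas A) \<beta>) = velocity A (snd \<circ> \<beta>)"
  using assms
  by (simp_all add: D_pi_I_def D_pi_O_def differential_fst differential_snd open_atlas_euclidean
        carrier_euclidean to_vec_velocity)

lemma curves_fst_in:
  fixes S :: "('a::euclidean_space \<times> 'o::topological_space) set"
    and A :: "('o, 'e::euclidean_space) chart set"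
  assumes "open_atlas A" "S \<subseteq> I \<times> carrier A"
    and "\<beta> \<in> curves (prod_atlas euclidean_atlas A) S (x, y)"
  shows "fst \<circ> \<beta> \<in> curves euclidean_atlas I x"
proof -
  have "S \<subseteq> carrier euclidean_atlas \<times> carrier A" using assms(2) by (auto simp: carrier_euclidean)
  then obtain \<epsilon> where \<epsilon>: "fst \<circ> \<beta> \<in> curves euclidean_atlas UNIV x" "\<epsilon> > 0" "\<beta> ` {-\<epsilon><..<\<epsilon>} \<subseteq> S"
    using assms(3) curves_prod_atlas_iff[OF open_atlas_euclidean assms(1), of S \<beta> "(x, y)"]
    by (auto simp: carrier_euclidean)
  show ?thesis
    by (rule curves_image_subset[OF \<epsilon>(1,2)]) (use \<epsilon>(3) assms(2) in fastforce)
qed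

lemma riemannian_norm_zero:
  assumes "riemannian_metric A g" "y \<in> carrier A"
  shows "riemannian_norm (g y) (\<lambda>c. 0) = 0"
proof -
  have z: "(\<lambda>c. 0) \<in> tangent_space A (carrier A) y"
    unfolding tangent_space_def
    using const_in_curves[OF assms(2), of A] velocity_const[of A y] by (metis image_eqI)
  have "g y (\<lambda>c. r *\<^sub>R u c + s *\<^sub>R v c) w = r * g y u w + s * g y v w"
    if "u \<in> tangent_space A (carrier A) y" "v \<in> tangent_space A (carrier A) y"
      "w \<in> tangent_space A (carrier A) y" for u v w r s
    using assms that unfolding riemannian_metric_def by blast
  from this[OF z z z, of 0 0] show ?thesis by (simp add: riemannian_norm_def)
qed

text \<open>The curve in \<open>S\<close> is lifted through its \<open>I\<close>-component. The lift starts in the relatively open set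
  \<open>W_CPP I\<close> and the given curve in the relatively open set of well-posed pairs, so both stay there.\<close>

lemma W_GCPP_curve:
  fixes S :: "('a::euclidean_space \<times> 'o::topological_space) set"
    and A :: "('o, 'e::euclidean_space) chart set"
  assumes flat: "flattening I U \<phi> \<psi> L" "x \<in> U" and A: "open_atlas A" and S: "S \<subseteq> I \<times> carrier A"
    and open_wp: "openin (top_of_set S) (well_posed I A S)"
    and W: "(a, x, y) \<in> W_GCPP I A S"
    and \<beta>: "\<beta> \<in> curves (prod_atlas euclidean_atlas A) S (x, y)"
    and s: "orth_proj (tangent I x) s = Hmap I x (a - x) (velocity_at (fst \<circ> \<beta>))"
  obtains \<alpha> where "(\<lambda>t. (\<alpha> t, \<beta> t)) \<in> curves (GCPP_atlas A) (W_GCPP I A S) (a, x, y)"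
    "velocity_at \<alpha> = s"
proof -
  interpret flattening I U \<phi> \<psi> L by (rule flat)
  let ?E = "euclidean_atlas :: ('a, 'a) chart set"
  have ax: "(a, x) \<in> W_CPP I" "(a, x) \<in> S_CPP I" and xy: "(x, y) \<in> well_posed I A S"
    using W by (auto simp: W_GCPP_def W_CPP_def)
  have \<xi>: "fst \<circ> \<beta> \<in> curves ?E I x" using curves_fst_in[OF A S \<beta>] .
  obtain \<alpha> \<epsilon> where \<alpha>: "\<alpha> \<in> curves ?E UNIV a" "velocity_at \<alpha> = s"
    "\<epsilon> > 0" "\<forall>t\<in>{-\<epsilon><..<\<epsilon>}. (\<alpha> t, (fst \<circ> \<beta>) t) \<in> S_CPP I"
    using lift_curve(2)[OF flat(2) ax(2) \<xi> s] by blast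
  obtain N where N: "open N" "(a, x) \<in> N" "S_CPP I \<inter> N \<subseteq> W_CPP I"
    using W_CPP_open[OF ax(1) flat(2)] by blast
  have "(\<lambda>t. (\<alpha> t, (fst \<circ> \<beta>) t)) \<in> curves (prod_atlas ?E ?E) (S_CPP I) (a, x)"
    using \<alpha> \<xi> unfolding curves_S_CPP_iff by (auto simp: o_def)
  then have "(\<lambda>t. (\<alpha> t, (fst \<circ> \<beta>) t)) \<in> curves (prod_atlas ?E ?E) (S_CPP I \<inter> N) (a, x)"
    by (rule curves_restrict) (use N ax in \<open>auto intro: openin_open_Int\<close>)
  then obtain \<epsilon>\<^sub>1 where 1: "\<epsilon>\<^sub>1 > 0" "(\<lambda>t. (\<alpha> t, (fst \<circ> \<beta>) t)) ` {-\<epsilon>\<^sub>1<..<\<epsilon>\<^sub>1} \<subseteq> S_CPP I \<inter> N"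
    by (rule curvesE)
  have "\<beta> \<in> curves (prod_atlas ?E A) (well_posed I A S) (x, y)"
    by (rule curves_restrict[OF \<beta> open_wp xy])
  then obtain \<epsilon>\<^sub>2 where 2: "\<epsilon>\<^sub>2 > 0" "\<beta> ` {-\<epsilon>\<^sub>2<..<\<epsilon>\<^sub>2} \<subseteq> well_posed I A S"
    by (rule curvesE)
  have "(\<alpha> t, \<beta> t) \<in> W_GCPP I A S" if t: "t \<in> {-min \<epsilon>\<^sub>1 \<epsilon>\<^sub>2<..<min \<epsilon>\<^sub>1 \<epsilon>\<^sub>2}" for t
  proof -
    have "t \<in> {-\<epsilon>\<^sub>1<..<\<epsilon>\<^sub>1}" "t \<in> {-\<epsilon>\<^sub>2<..<\<epsilon>\<^sub>2}" using t by auto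
    then have "(\<alpha> t, (fst \<circ> \<beta>) t) \<in> S_CPP I \<inter> N" "\<beta> t \<in> well_posed I A S"
      using 1(2) 2(2) by blast+
    then have "(\<alpha> t, fst (\<beta> t)) \<in> W_CPP I" "\<beta> t \<in> well_posed I A S" using N(3) by auto
    then show ?thesis by (cases "\<beta> t") (auto simp: W_GCPP_def)
  qed
  then have "\<exists>\<epsilon>>0. (\<lambda>t. (\<alpha> t, \<beta> t)) ` {-\<epsilon><..<\<epsilon>} \<subseteq> W_GCPP I A S"
    using 1(1) 2(1) by (intro exI[of _ "min \<epsilon>\<^sub>1 \<epsilon>\<^sub>2"]) auto
  moreover have "\<beta> \<in> curves (prod_atlas ?E A) (carrier (prod_atlas ?E A)) (x, y)"
    by (rule subsetD[OF curves_mono \<beta>]) (use S in \<open>auto simp: carrier_prod_atlas carrier_euclidean\<close>)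
  moreover have "W_GCPP I A S \<subseteq> carrier ?E \<times> carrier (prod_atlas ?E A)"
    using S by (auto simp: W_GCPP_def well_posed_def carrier_prod_atlas carrier_euclidean)
  ultimately have "(\<lambda>t. (\<alpha> t, \<beta> t)) \<in> curves (GCPP_atlas A) (W_GCPP I A S) (a, x, y)"
    using \<alpha>(1) A unfolding GCPP_atlas_def
    by (subst curves_prod_atlas_iff)
       (auto simp: open_atlas_euclidean open_atlas_prod carrier_euclidean o_def)
  then show ?thesis using that \<alpha>(2) by blast
qed

text \<open>For a curve in \<open>W_GCPP\<close> the velocity of the first component, \<open>s\<close>, determines the velocity in \<open>S\<close>
  as \<open>D_pi_I\<inverse> (H\<inverse> (P s))\<close>, and each \<open>s\<close> occurs by \<open>W_GCPP_curve\<close>. This gives both the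
  bijectivity demanded in the definition of the condition number and the operator whose norm is
  taken, namely the one on the right-hand side precomposed with \<open>P\<close>.\<close>

lemma cond_GCPP_well_posed:
  fixes S :: "('a::euclidean_space \<times> 'o::topological_space) set"
    and A :: "('o, 'e::euclidean_space) chart set"
  assumes flat: "flattening I U \<phi> \<psi> L" "x \<in> U" and A: "open_atlas A" and S: "S \<subseteq> I \<times> carrier A"
    and g: "riemannian_metric A g"
    and open_wp: "openin (top_of_set S) (well_posed I A S)"
    and W: "(a, x, y) \<in> W_GCPP I A S"
  shows "cond_GCPP I A g S (a, x, y) =
    spectral_norm (tangent I x) (riemannian_norm (g y))
      (D_pi_O A S (x, y) \<circ> inv_into (tangent_S A S (x, y)) (D_pi_I A S (x, y)) \<circ>
       inv_into (tangent I x) (Hmap I x (a - x)))"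
proof -
  interpret flattening I U \<phi> \<psi> L by (rule flat)
  let ?E = "euclidean_atlas :: ('a, 'a) chart set"
  let ?Q = "prod_atlas ?E A" and ?T = "tangent I x" and ?H = "Hmap I x (a - x)"
  let ?W = "W_GCPP I A S" and ?TS = "tangent_S A S (x, y)" and ?DI = "D_pi_I A S (x, y)"
  let ?C = "curves (GCPP_atlas A) ?W (a, x, y)" and ?v = "velocity (GCPP_atlas A)"
  let ?DR = "to_vec \<circ> differential (GCPP_atlas A) ?W ?E fst (a, x, y)"
  let ?DO = "differential (GCPP_atlas A) ?W A (snd \<circ> snd) (a, x, y)"
  define R where "R = D_pi_O A S (x, y) \<circ> inv_into ?TS ?DI \<circ> inv_into ?T ?H"
  have S': "S \<subseteq> UNIV \<times> carrier A" using S by auto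
  have ax: "(a, x) \<in> W_CPP I" "(a, x) \<in> S_CPP I" and xy: "(x, y) \<in> S" "bij_betw ?DI ?TS ?T"
    using W by (auto simp: W_GCPP_def W_CPP_def well_posed_def)
  have H: "bij_betw ?H ?T ?T" using W_CPP_iff_Hmap[OF flat(2) ax(2)] ax(1) by blast
  have T: "subspace ?T" using subspace_tangent[OF flat(2)] ax(2) by (simp add: S_CPP_iff)
  have Q: "open_atlas ?Q" by (intro open_atlas_prod open_atlas_euclidean A)
  have WQ: "?W \<subseteq> carrier ?E \<times> carrier ?Q"
    using S by (auto simp: W_GCPP_def well_posed_def carrier_prod_atlas carrier_euclidean)
  note v_eq = velocity_prod_atlas_eq_iff[OF open_atlas_euclidean Q WQ, folded GCPP_atlas_def]
  have in_S: "snd \<circ> \<gamma> \<in> curves ?Q S (x, y)"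
    and vS: "velocity ?Q (snd \<circ> \<gamma>) = inv_into ?TS ?DI (inv_into ?T ?H (orth_proj ?T (velocity_at (fst \<circ> \<gamma>))))"
    if \<gamma>: "\<gamma> \<in> ?C" for \<gamma>
  proof -
    obtain \<epsilon> where \<epsilon>: "\<epsilon> > 0" "\<gamma> ` {-\<epsilon><..<\<epsilon>} \<subseteq> ?W" "fst \<circ> \<gamma> \<in> curves ?E UNIV a"
      "snd \<circ> \<gamma> \<in> curves ?Q (carrier ?Q) (x, y)"
      using \<gamma> curves_prod_atlas_iff[OF open_atlas_euclidean Q WQ, of \<gamma> "(a, x, y)"]
      by (auto simp: GCPP_atlas_def carrier_euclidean)
    have mem: "(fst (\<gamma> t), fst (snd (\<gamma> t))) \<in> S_CPP I" "snd (\<gamma> t) \<in> S" if "t \<in> {-\<epsilon><..<\<epsilon>}" for t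
    proof -
      have "\<gamma> t \<in> ?W" using \<epsilon>(2) that by blast
      then show "(fst (\<gamma> t), fst (snd (\<gamma> t))) \<in> S_CPP I" "snd (\<gamma> t) \<in> S"
        by (cases "\<gamma> t"; force simp: W_GCPP_def W_CPP_def well_posed_def)+
    qed
    show S_curve: "snd \<circ> \<gamma> \<in> curves ?Q S (x, y)"
      by (rule curves_image_subset[OF \<epsilon>(4,1)]) (use mem(2) in auto)
    have I_curve: "fst \<circ> (snd \<circ> \<gamma>) \<in> curves ?E I x" by (rule curves_fst_in[OF A S S_curve])
    let ?u = "velocity_at (fst \<circ> (snd \<circ> \<gamma>))"
    have "?u \<in> ?T" unfolding tangent_eq using I_curve by blast
    moreover have "?H ?u = orth_proj ?T (velocity_at (fst \<circ> \<gamma>))"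
      by (rule Hmap_velocity[OF flat(2) \<epsilon>(3) I_curve \<epsilon>(1)]) (use mem(1) in simp)
    ultimately have u: "inv_into ?T ?H (orth_proj ?T (velocity_at (fst \<circ> \<gamma>))) = ?u"
      using H by (metis bij_betw_imp_inj_on inv_into_f_f)
    have "velocity ?Q (snd \<circ> \<gamma>) \<in> ?TS" unfolding tangent_space_def using S_curve by blast
    with u D_pi_I_velocity[OF A S' S_curve]
    show "velocity ?Q (snd \<circ> \<gamma>) = inv_into ?TS ?DI (inv_into ?T ?H (orth_proj ?T (velocity_at (fst \<circ> \<gamma>))))"
      using xy(2) by (metis bij_betw_imp_inj_on inv_into_f_f)
  qed
  have DR: "?DR (?v \<gamma>) = velocity_at (fst \<circ> \<gamma>)" if "\<gamma> \<in> ?C" for \<gamma>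
    using differential_fst[OF open_atlas_euclidean Q WQ] that
    by (simp add: GCPP_atlas_def to_vec_velocity)
  have DO: "?DO (?v \<gamma>) = R (orth_proj ?T (velocity_at (fst \<circ> \<gamma>)))" if \<gamma>: "\<gamma> \<in> ?C" for \<gamma>
  proof -
    have snd_v: "velocity A (snd \<circ> (snd \<circ> \<delta>)) = D_pi_O A S (x, y) (velocity ?Q (snd \<circ> \<delta>))"
      if "\<delta> \<in> ?C" for \<delta>
      using D_pi_O_velocity[OF A S' in_S[OF that]] by simp
    have "?DO (?v \<gamma>) = velocity A (snd \<circ> snd \<circ> \<gamma>)"
    proof (rule differential_velocity[OF \<gamma>])
      fix \<delta> assume \<delta>: "\<delta> \<in> ?C" and "?v \<delta> = ?v \<gamma>"
      then have "velocity ?Q (snd \<circ> \<delta>) = velocity ?Q (snd \<circ> \<gamma>)" using v_eq[OF \<delta> \<gamma>] by blast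
      then show "velocity A (snd \<circ> snd \<circ> \<delta>) = velocity A (snd \<circ> snd \<circ> \<gamma>)"
        using snd_v[OF \<gamma>] snd_v[OF \<delta>] by (simp add: comp_assoc)
    qed
    then show ?thesis using snd_v[OF \<gamma>] vS[OF \<gamma>] by (simp add: R_def comp_assoc)
  qed
  have ex: "\<exists>\<gamma>\<in>?C. velocity_at (fst \<circ> \<gamma>) = s" for s
  proof -
    let ?u = "inv_into ?T ?H (orth_proj ?T s)"
    have P: "orth_proj ?T s \<in> ?T" using orth_proj_in[OF T] .
    then have u: "?u \<in> ?T" and Hu: "?H ?u = orth_proj ?T s"
      using inv_into_into[of "orth_proj ?T s" ?H ?T] f_inv_into_f[of "orth_proj ?T s" ?H ?T]
        bij_betw_imp_surj_on[OF H] by auto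
    have "?u \<in> ?DI ` velocity ?Q ` curves ?Q S (x, y)"
      using u bij_betw_imp_surj_on[OF xy(2)] unfolding tangent_space_def by simp
    then obtain \<beta> where \<beta>: "\<beta> \<in> curves ?Q S (x, y)" "?DI (velocity ?Q \<beta>) = ?u" by auto
    have "orth_proj ?T s = ?H (velocity_at (fst \<circ> \<beta>))"
      using \<beta>(2) Hu D_pi_I_velocity[OF A S' \<beta>(1)] by simp
    from W_GCPP_curve[OF flat A S open_wp W \<beta>(1) this] obtain \<alpha>
      where \<alpha>: "(\<lambda>t. (\<alpha> t, \<beta> t)) \<in> ?C" "velocity_at \<alpha> = s" by blast
    then show ?thesis by (intro bexI[OF _ \<alpha>(1)]) (simp add: o_def)
  qed
  have bij: "bij_betw ?DR (tangent_space (GCPP_atlas A) ?W (a, x, y)) UNIV"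
    unfolding bij_betw_def tangent_space_def
  proof
    show "inj_on ?DR (?v ` ?C)"
    proof (rule inj_onI, elim imageE, simp only:)
      fix \<gamma> \<delta> assume \<gamma>: "\<gamma> \<in> ?C" and \<delta>: "\<delta> \<in> ?C" and "?DR (?v \<gamma>) = ?DR (?v \<delta>)"
      then have "velocity_at (fst \<circ> \<gamma>) = velocity_at (fst \<circ> \<delta>)" using DR by simp
      then show "?v \<gamma> = ?v \<delta>" using v_eq[OF \<gamma> \<delta>] vS[OF \<gamma>] vS[OF \<delta>] by (simp add: velocity_euclidean_eq_iff)
    qed
    have "s \<in> ?DR ` ?v ` ?C" for s
    proof -
      obtain \<gamma> where \<gamma>: "\<gamma> \<in> ?C" "velocity_at (fst \<circ> \<gamma>) = s" using ex by blast
      then have "s = ?DR (?v \<gamma>)" using DR[OF \<gamma>(1)] by simp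
      then show ?thesis using \<gamma>(1) by blast
    qed
    then show "?DR ` ?v ` ?C = UNIV" by blast
  qed
  have "?DO (inv_into (tangent_space (GCPP_atlas A) ?W (a, x, y)) ?DR s) = R (orth_proj ?T s)" for s
  proof -
    obtain \<gamma> where \<gamma>: "\<gamma> \<in> ?C" "velocity_at (fst \<circ> \<gamma>) = s" using ex by blast
    have "?v \<gamma> \<in> tangent_space (GCPP_atlas A) ?W (a, x, y)" unfolding tangent_space_def using \<gamma>(1) by blast
    then have "inv_into (tangent_space (GCPP_atlas A) ?W (a, x, y)) ?DR s = ?v \<gamma>"
      using DR[OF \<gamma>(1)] \<gamma>(2) bij by (metis bij_betw_imp_inj_on inv_into_f_f)
    then show ?thesis using DO[OF \<gamma>(1)] \<gamma>(2) by simp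
  qed
  then have "cond_GCPP I A g S (a, x, y)
      = spectral_norm UNIV (riemannian_norm (g y)) (\<lambda>s. R (orth_proj ?T s))"
    using W bij unfolding cond_GCPP_def Let_def by (simp add: o_def)
  also have "\<dots> = spectral_norm ?T (riemannian_norm (g y)) R"
  proof (rule spectral_norm_orth_proj[OF T])
    \<comment> \<open>The constant curve shows that the operator maps 0 to the zero tangent vector.\<close>
    let ?c = "\<lambda>t::real. (a, x, y)"
    have c: "?c \<in> ?C" using W by (rule const_in_curves)
    have "snd \<circ> ?c = (\<lambda>t. (x, y))" "fst \<circ> ?c = (\<lambda>t. a)" "snd \<circ> (\<lambda>t::real. (x, y)) = (\<lambda>t. y)"
      by (auto simp: fun_eq_iff)
    then have "R 0 = velocity A (\<lambda>t. y)"
      using vS[OF c] D_pi_O_velocity[OF A S' in_S[OF c]] orth_proj_id[OF T subspace_0[OF T]]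
      by (simp add: R_def)
    moreover have "y \<in> carrier A" using xy(1) S by auto
    ultimately show "riemannian_norm (g y) (R 0) = 0"
      using riemannian_norm_zero[OF g] by (simp add: velocity_const)
  qed
  finally show ?thesis unfolding R_def .
qed

theorem theorem6p2:
  fixes I :: "(real ^ 'n) set"
    and A :: "('o::{t2_space,second_countable_topology}, 'e::euclidean_space) chart set"
    and g :: "'o \<Rightarrow> ('o, 'e) tangent_vector \<Rightarrow> ('o, 'e) tangent_vector \<Rightarrow> real"
    and S :: "((real ^ 'n) \<times> 'o) set"
    and m d :: nat and a x :: "real ^ 'n" and y :: 'o
  assumes I: "embedded_submanifold CARD('n) euclidean_atlas m I"
    and O: "smooth_manifold d A" "riemannian_metric A g"
    and S: "embedded_submanifold (m + d)
              (prod_atlas (sub_atlas CARD('n) euclidean_atlas m I) A) m S"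
    and surj: "fst ` S = I"
    and W_open: "openin (top_of_set S) (well_posed I A S)"
    and W_dense: "S \<subseteq> closure (well_posed I A S)"
    and p: "(a, x, y) \<in> S_GCPP I S"
  shows "cond_GCPP I A g S (a, x, y) =
           (if bij_betw (D_pi_I A S (x, y)) (tangent_S A S (x, y)) (tangent I x) \<and>
               bij_betw (Hmap I x (a - x)) (tangent I x) (tangent I x)
            then spectral_norm (tangent I x) (riemannian_norm (g y))
                   (D_pi_O A S (x, y) \<circ>
                    inv_into (tangent_S A S (x, y)) (D_pi_I A S (x, y)) \<circ>
                    inv_into (tangent I x) (Hmap I x (a - x)))
            else \<infinity>)
         \<and> ((a, x, y) \<in> S_GCPP I S - W_GCPP I A S \<longrightarrow>
              \<not> bij_betw (D_pi_I A S (x, y)) (tangent_S A S (x, y)) (tangent I x) \<or>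
              \<not> bij_betw (Hmap I x (a - x)) (tangent I x) (tangent I x))"
proof -
  have ax: "(a, x) \<in> S_CPP I" and xy: "(x, y) \<in> S" using p by (auto simp: S_GCPP_def)
  have A: "open_atlas A" using O(1) by (rule open_atlas_smooth_manifold)
  have SA: "S \<subseteq> I \<times> carrier A"
    using embedded_submanifold_subset_carrier[OF S] surj by (force simp: carrier_prod_atlas)
  obtain U \<phi> \<psi> L where flat: "flattening I U \<phi> \<psi> L" "x \<in> U"
  proof (rule embedded_submanifold_flattening)
    show "embedded_submanifold DIM(real ^ 'n) euclidean_atlas m I" using I by simp
    show "x \<in> I" using ax by (simp add: S_CPP_iff)
  qed
  have W: "(a, x, y) \<in> W_GCPP I A S \<longleftrightarrow>
      bij_betw (D_pi_I A S (x, y)) (tangent_S A S (x, y)) (tangent I x) \<and>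
      bij_betw (Hmap I x (a - x)) (tangent I x) (tangent I x)"
    using flattening.W_CPP_iff_Hmap[OF flat ax] xy by (auto simp: W_GCPP_def well_posed_def)
  show ?thesis
  proof (cases "(a, x, y) \<in> W_GCPP I A S")
    case True
    then show ?thesis
      using W cond_GCPP_well_posed[OF flat A SA O(2) W_open True] by simp
  next
    case False
    then have "cond_GCPP I A g S (a, x, y) = \<infinity>" by (simp add: cond_GCPP_def)
    then show ?thesis using W False by auto
  qed
qed

end
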